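(* Let $\nu$ be a Lévy measure on $\mathbb{R}^d$ such that $$\int_{\|u\|\ge1}\|u\|\nu(du)<+\infty,\qquad \nu(du)=\mathbf 1_{(0,+\infty)}(r)\mathbf 1_{\mathbb{S}^{d-1}}(x)\frac{k_x(r)}{r}dr\,\sigma(dx),$$ where $\sigma$ is a finite positive measure on $\mathbb{S}^{d-1}$ and where $k_x(r)$ is a nonnegative continuous function decreasing in $r\in(0,+\infty)$, continuous in $x\in\mathbb{S}^{d-1}$, with $\lim_{r\to+\infty}k_x(r)=0$ and $\lim_{r\to0^+}r^2k_x(r)=0$, $x\in\mathbb{S}^{d-1}$. Let $\mathcal{A}$ be the operator defined, for all $f\in\mathcal{S}(\mathbb{R}^d)$ and all $x\in\mathbb{R}^d$, by $$\mathcal{A}(f)(x)=-\langle x;\nabla f(x)\rangle+\int_{\mathbb{R}^d}\langle\nabla f(x+u)-\nabla f(x);u\rangle\nu(du).$$ Then, for all $f,g\in\mathcal{S}(\mathbb{R}^d)$ and all $x\in\mathbb{R}^d$, $$\Gamma_2(f,g)(x)=\int_{\mathbb{R}^d}\int_{\mathbb{R}^d}\mathcal{F}(f)(\xi)\mathcal{F}(g)(\zeta)e^{i\langle x;\xi+\zeta\rangle}\Big(\frac{\sigma_{\tilde\nu}(\xi,\zeta)^2}{4}+\frac{\rho_{\tilde\nu}(\xi,\zeta)}{4}\Big)\frac{d\xi\,d\zeta}{(2\pi)^{2d}},$$ where, for all $\xi,\zeta\in\mathbb{R}^d$, $$\sigma_{\tilde\nu}(\xi,\zeta)=\int_{\mathbb{R}^d}\big(e^{i\langle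 u;\xi\rangle}-1\big)\big(e^{i\langle u;\zeta\rangle}-1\big)\tilde\nu(du),$$ $$\rho_{\tilde\nu}(\xi,\zeta)=\int_{\mathbb{R}^d}i\langle u;\zeta\rangle e^{i\langle u;\zeta\rangle}\big(e^{i\langle u;\xi\rangle}-1\big)\tilde\nu(du)+\int_{\mathbb{R}^d}i\langle u;\xi\rangle e^{i\langle u;\xi\rangle}\big(e^{i\langle u;\zeta\rangle}-1\big)\tilde\nu(du),$$ with $\tilde\nu(du)=\mathbf 1_{(0,+\infty)}(r)\mathbf 1_{\mathbb{S}^{d-1}}(x)(-dk_x(r))\sigma(dx)$.
   Context: $\|\cdot\|$, $\langle\cdot;\cdot\rangle$: Euclidean norm and inner product; $\mathbb{S}^{d-1}$: unit sphere; polar coordinates $u=rx$; $\mathcal{S}(\mathbb{R}^d)$: Schwartz space of real-valued functions; $\mathcal{F}(f)(\xi)=\int_{\mathbb{R}^d}f(x)e^{-i\langle\xi;x\rangle}dx$. A Lévy measure is a positive Borel measure $\nu$ on $\mathbb{R}^d$ with $\nu(\{0\})=0$ and $\int(1\wedge\|u\|^2)\nu(du)<+\infty$. "Decreasing" means non-increasing; $-dk_x(r)$ is the positive Lebesgue–Stieltjes measure of the decreasing function $k_x$. The carré du champs operator is $$\Gamma_1(f,g)(x)=\Gamma(f,g)(x)=\frac12\int_{\mathbb{R}^d}(f(x+u)-f(x))(g(x+u)-g(x))\tilde\nu(du)=\frac12\big(\mathcal{A}(fg)-f\mathcal{A}(g)-g\mathcal{A}(f)\big)(x),$$ and the iterated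 carré du champs of order 2 is $$\Gamma_2(f,g)(x)=\frac12\big(\mathcal{A}(\Gamma_1(f,g))(x)-\Gamma_1(\mathcal{A}(f),g)(x)-\Gamma_1(\mathcal{A}(g),f)(x)\big),$$ where $\mathcal{A}$ and $\Gamma_1$ are applied to the smooth functions $\Gamma_1(f,g)$, $\mathcal{A}(f)$, $\mathcal{A}(g)$ through their integral formulas. *)

theory Defs
  imports "HOL-Analysis.Analysis"
begin

definition grad :: "('a::euclidean_space \<Rightarrow> real) \<Rightarrow> 'a \<Rightarrow> 'a" where
  "grad f x = (THE D. GDERIV f x :> D)"

text \<open>
  A list of basis vectors encodes a multi-index: \<open>iter_partial [b\<^sub>1, \<dots>, b\<^sub>m] f\<close> is the partial
  derivative of order \<open>m\<close> of \<open>f\<close> along \<open>b\<^sub>m, \<dots>, b\<^sub>1\<close>.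
\<close>

fun iter_partial :: "'a::euclidean_space list \<Rightarrow> ('a \<Rightarrow> real) \<Rightarrow> 'a \<Rightarrow> real" where
  "iter_partial [] f = f"
| "iter_partial (b # bs) f = (\<lambda>x. frechet_derivative (iter_partial bs f) (at x) b)"

text \<open>
  Differentiability of all the iterated partial derivatives is smoothness, since a differentiable
  function is continuous and a function with continuous partial derivatives is differentiable.
\<close>

definition schwartz :: "('a::euclidean_space \<Rightarrow> real) \<Rightarrow> bool" where
  "schwartz f \<longleftrightarrow>
     (\<forall>bs. set bs \<subseteq> Basis \<longrightarrow>
        (\<forall>x. iter_partial bs f differentiable (at x)) \<and>
        (\<forall>n::nat. bounded (range (\<lambda>x. norm x ^ n * iter_partial bs f x))))"

definition fourier :: "('a::euclidean_space \<Rightarrow> real) \<Rightarrow> 'a \<Rightarrow> complex" where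
  "fourier f \<xi> = (\<integral>x. complex_of_real (f x) * exp (- (\<i> * complex_of_real (\<xi> \<bullet> x))) \<partial>lborel)"

definition levy_measure :: "'a::euclidean_space measure \<Rightarrow> bool" where
  "levy_measure \<nu> \<longleftrightarrow>
     sets \<nu> = sets borel \<and> emeasure \<nu> {0} = 0 \<and>
     (\<integral>\<^sup>+u. ennreal (min 1 ((norm u)\<^sup>2)) \<partial>\<nu>) < \<infinity>"

text \<open>
  The measure \<open>\<mu>\<^sub>x(dr) \<sigma>(dx)\<close> in polar coordinates \<open>u = r x\<close>, that is
  \<open>B \<mapsto> \<integral> \<mu>\<^sub>x {r. r x \<in> B} \<sigma>(dx)\<close>. Here \<open>\<sigma>\<close> lives on the unit sphere and each \<open>\<mu>\<^sub>x\<close> on the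
  positive half-line; \<open>\<mu>\<^sub>x\<close> may be infinite, which excludes the Giry monad. Beware that
  \<open>measure_of\<close> yields the null measure unless the set function is countably additive, which
  follows from measurability in \<open>x\<close> (lemma \<open>emeasure_polar_measure\<close>).
\<close>

definition polar_measure :: "'a::euclidean_space measure \<Rightarrow> ('a \<Rightarrow> real measure) \<Rightarrow> 'a measure" where
  "polar_measure \<sigma> \<mu> =
     measure_of UNIV (sets borel)
       (\<lambda>B. \<integral>\<^sup>+x. emeasure (distr (\<mu> x) borel (\<lambda>r. r *\<^sub>R x)) B \<partial>\<sigma>)"

lemma sets_polar_measure [simp, measurable_cong]: "sets (polar_measure \<sigma> \<mu>) = sets borel"
  unfolding polar_measure_def by (metis sets.sets_measure_of_eq space_borel)

lemma emeasure_polar_measure: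
  fixes \<sigma> :: "'a::euclidean_space measure"
  assumes meas: "\<And>B. B \<in> sets borel \<Longrightarrow>
      (\<lambda>x. emeasure (distr (\<mu> x) borel (\<lambda>r. r *\<^sub>R x)) B) \<in> borel_measurable \<sigma>"
    and B: "B \<in> sets borel"
  shows "emeasure (polar_measure \<sigma> \<mu>) B =
    (\<integral>\<^sup>+x. emeasure (distr (\<mu> x) borel (\<lambda>r. r *\<^sub>R x)) B \<partial>\<sigma>)"
proof (rule emeasure_measure_of[OF polar_measure_def])
  show "positive (sets (polar_measure \<sigma> \<mu>))
      (\<lambda>B. \<integral>\<^sup>+x. emeasure (distr (\<mu> x) borel (\<lambda>r. r *\<^sub>R x)) B \<partial>\<sigma>)"
    by (simp add: positive_def)
  show "countably_additive (sets (polar_measure \<sigma> \<mu>))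
      (\<lambda>B. \<integral>\<^sup>+x. emeasure (distr (\<mu> x) borel (\<lambda>r. r *\<^sub>R x)) B \<partial>\<sigma>)"
  proof (rule countably_additiveI)
    fix A :: "nat \<Rightarrow> 'a set"
    assume A: "range A \<subseteq> sets (polar_measure \<sigma> \<mu>)" "disjoint_family A"
    have "(\<Sum>i. \<integral>\<^sup>+x. emeasure (distr (\<mu> x) borel (\<lambda>r. r *\<^sub>R x)) (A i) \<partial>\<sigma>) =
        (\<integral>\<^sup>+x. (\<Sum>i. emeasure (distr (\<mu> x) borel (\<lambda>r. r *\<^sub>R x)) (A i)) \<partial>\<sigma>)"
      using A by (intro nn_integral_suminf[symmetric] meas) auto
    also have "\<dots> = (\<integral>\<^sup>+x. emeasure (distr (\<mu> x) borel (\<lambda>r. r *\<^sub>R x)) (\<Union>i. A i) \<partial>\<sigma>)"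
      using A by (intro nn_integral_cong suminf_emeasure) auto
    finally show "(\<Sum>i. \<integral>\<^sup>+x. emeasure (distr (\<mu> x) borel (\<lambda>r. r *\<^sub>R x)) (A i) \<partial>\<sigma>) =
        (\<integral>\<^sup>+x. emeasure (distr (\<mu> x) borel (\<lambda>r. r *\<^sub>R x)) (\<Union>i. A i) \<partial>\<sigma>)" .
  qed
qed (use B in auto)

text \<open>
  The Lebesgue--Stieltjes measure \<open>-dh\<close> of a non-increasing continuous function \<open>h\<close> on the open
  half-line, following the library's \<open>interval_measure\<close>. The latter does not apply directly
  because \<open>h\<close> may be unbounded near \<open>0\<close>.
\<close>

definition neg_stieltjes :: "(real \<Rightarrow> real) \<Rightarrow> real measure" where
  "neg_stieltjes h =
     extend_measure {0<..} {(a, b). 0 < a \<and> a \<le> b} (\<lambda>(a, b). {a<..b}) (\<lambda>(a, b). ennreal (h a - h b))"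

lemma space_neg_stieltjes [simp]: "space (neg_stieltjes h) = {0<..}"
  unfolding neg_stieltjes_def by (subst space_extend_measure) auto

lemma sets_neg_stieltjes:
  "sets (neg_stieltjes h) = sigma_sets {0<..} ((\<lambda>(a, b). {a<..b}) ` {(a, b). 0 < a \<and> a \<le> b})"
  unfolding neg_stieltjes_def by (subst sets_extend_measure) auto

lemma emeasure_neg_stieltjes_Ioc:
  assumes anti: "antimono_on {0<..} h" and cont: "continuous_on {0<..} h" and ab: "0 < a" "a \<le> b"
  shows "emeasure (neg_stieltjes h) {a<..b} = ennreal (h a - h b)"
proof -
  define F where "F s = - h (exp s)" for s
  have monoF: "F x \<le> F y" if "x \<le> y" for x y
    using anti that unfolding F_def monotone_on_def by auto
  have contF: "continuous_on UNIV F"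
    unfolding F_def by (intro continuous_intros continuous_on_compose2[OF cont]) auto
  then have rcont: "continuous (at_right c) F" for c
    by (meson UNIV_I continuous_on_eq_continuous_within continuous_within_subset subset_UNIV)
  define M where "M = restrict_space (distr (interval_measure F) borel exp) {0<..}"
  have M_Ioc: "emeasure M {c<..d} = ennreal (h c - h d)" if "0 < c" "c \<le> d" for c d
  proof -
    have pre: "exp -` {c<..d} = {ln c<..ln d}"
    proof (rule set_eqI)
      fix s :: real
      show "s \<in> exp -` {c<..d} \<longleftrightarrow> s \<in> {ln c<..ln d}"
        using that ln_less_cancel_iff[of c "exp s"] ln_le_cancel_iff[of "exp s" d] by simp
    qed
    have "emeasure M {c<..d} = emeasure (distr (interval_measure F) borel exp) {c<..d}"
      unfolding M_def using that by (subst emeasure_restrict_space) auto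
    also have "\<dots> = emeasure (interval_measure F) {ln c<..ln d}"
      by (subst emeasure_distr) (auto simp: pre)
    also have "\<dots> = ennreal (F (ln d) - F (ln c))"
      using that by (intro emeasure_interval_measure_Ioc monoF rcont) auto
    finally show ?thesis
      using that by (simp add: F_def)
  qed
  have sub: "sets (neg_stieltjes h) \<subseteq> sets M"
    unfolding sets_neg_stieltjes
    by (rule sets.sigma_sets_subset') (auto simp: M_def sets_restrict_space_iff space_restrict_space)
  show ?thesis
  proof (rule emeasure_extend_measure_Pair[OF neg_stieltjes_def, where \<mu>' = "emeasure M"])
    show "positive (sets (neg_stieltjes h)) (emeasure M)"
      by (simp add: positive_def)
    show "countably_additive (sets (neg_stieltjes h)) (emeasure M)"
      using sub by (auto simp: countably_additive_def intro!: suminf_emeasure)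
  qed (use ab M_Ioc in auto)
qed

text \<open>The operator \<open>\<A>\<close>, defined by its integral formula for arbitrary functions.\<close>

definition levy_op :: "'a::euclidean_space measure \<Rightarrow> ('a \<Rightarrow> real) \<Rightarrow> 'a \<Rightarrow> real" where
  "levy_op \<nu> f x = - (x \<bullet> grad f x) + (\<integral>u. (grad f (x + u) - grad f x) \<bullet> u \<partial>\<nu>)"

definition Gamma1 ::
  "'a::euclidean_space measure \<Rightarrow> ('a \<Rightarrow> real) \<Rightarrow> ('a \<Rightarrow> real) \<Rightarrow> 'a \<Rightarrow> real" where
  "Gamma1 \<mu> f g x = 1 / 2 * (\<integral>u. (f (x + u) - f x) * (g (x + u) - g x) \<partial>\<mu>)"

definition Gamma2 ::
  "'a::euclidean_space measure \<Rightarrow> 'a measure \<Rightarrow> ('a \<Rightarrow> real) \<Rightarrow> ('a \<Rightarrow> real) \<Rightarrow> 'a \<Rightarrow> real" where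
  "Gamma2 \<nu> \<mu> f g x =
     1 / 2 * (levy_op \<nu> (Gamma1 \<mu> f g) x - Gamma1 \<mu> (levy_op \<nu> f) g x - Gamma1 \<mu> (levy_op \<nu> g) f x)"

definition sigma_symbol :: "'a::euclidean_space measure \<Rightarrow> 'a \<Rightarrow> 'a \<Rightarrow> complex" where
  "sigma_symbol \<mu> \<xi> \<zeta> =
     (\<integral>u. (exp (\<i> * complex_of_real (u \<bullet> \<xi>)) - 1) * (exp (\<i> * complex_of_real (u \<bullet> \<zeta>)) - 1) \<partial>\<mu>)"

definition rho_symbol :: "'a::euclidean_space measure \<Rightarrow> 'a \<Rightarrow> 'a \<Rightarrow> complex" where
  "rho_symbol \<mu> \<xi> \<zeta> =
     (\<integral>u. \<i> * complex_of_real (u \<bullet> \<zeta>) * exp (\<i> * complex_of_real (u \<bullet> \<zeta>))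
            * (exp (\<i> * complex_of_real (u \<bullet> \<xi>)) - 1) \<partial>\<mu>) +
     (\<integral>u. \<i> * complex_of_real (u \<bullet> \<xi>) * exp (\<i> * complex_of_real (u \<bullet> \<xi>))
            * (exp (\<i> * complex_of_real (u \<bullet> \<zeta>)) - 1) \<partial>\<mu>)"

end

theory Submission
  imports Defs "HOL-Probability.Sinc_Integral" "HOL-Probability.Characteristic_Functions"
begin

text \<open>
  In polar coordinates \<open>k\<^sub>x(r) = \<integral> 1\<^bsub>s > r\<^esub> (-dk\<^sub>x)(ds)\<close>, so \<open>\<nu>\<close> is the image of \<open>ds/s \<otimes> \<nu>t\<close> on
  \<open>(0, 1) \<times> \<real>\<^sup>d\<close> under \<open>(s, v) \<mapsto> s v\<close>; in particular both measures integrate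
  \<open>min \<bar>u\<bar> \<bar>u\<bar>\<^sup>2\<close>. Consequently the jump part of \<open>\<A>\<close> multiplies the plane wave with
  frequency \<open>\<xi>\<close> by \<open>\<psi>(\<xi>) = \<integral> (e\<^bsup>i u \<bullet> \<xi>\<^esup> - 1 - i u \<bullet> \<xi>) \<nu>t(du)\<close>, and
  \<open>\<psi>(\<xi> + \<zeta>) - \<psi>(\<xi>) - \<psi>(\<zeta>)\<close> is the symbol \<open>\<sigma>\<close>. By Fourier inversion \<open>f\<close> and \<open>g\<close> are
  superpositions of plane waves with rapidly decreasing weights, and by Fubini so are the
  functions to which \<open>\<A>\<close> and \<open>\<Gamma>\<^sub>1\<close> are applied in \<open>\<Gamma>\<^sub>2\<close>. Comparing symbols, the jump parts
  contribute \<open>\<sigma>\<^sup>2 / 4\<close>, while in the drift terms everything cancels but \<open>\<rho> / 4\<close>.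
\<close>

section \<open>Lebesgue integration on Euclidean spaces\<close>

text \<open>The second application of the operators meets functions that are not known to be
  Schwartz: \<open>levy_op \<nu> f\<close> carries a factor linear in x, and
  \<open>Gamma1 \<nu>t f g\<close> is given only by an integral. The locale \<open>wave\<close>
  therefore keeps just a complex density with finite second frequency moment over an arbitrary
  sigma-finite index space: single frequencies for f and g, pairs with frequency \<xi> + \<zeta> for
  \<open>Gamma1 \<nu>t f g\<close>. Second moments suffice because \<psi> grows at most
  quadratically. Origin of \<rho>: owing to the drift, the plane wave with frequency \<xi> gets the
  multiplier \<psi>(\<xi>) - i x.\<xi>, which depends on the position. Between x and x + u it
  changes by - i u.\<xi>, and pairing this change with the increment of the other function gives one
  half of \<rho>. The terms in x itself cancel, being linear in the frequency. The polar measures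
  need measurability in the direction, and -dk may have infinite mass near 0. Writing -dk as the
  image of Lebesgue measure under a generalised inverse of k, jointly measurable in direction and
  level, settles both; the invariance of dr/r under dilations then produces ds/s.\<close>

lemma norm_iexp_minus_one: "cmod (iexp s - 1) \<le> min 2 \<bar>s\<bar>"
  using iexp_approx1[of s 0] iexp_approx2[of s 0] by simp

text \<open>Taylor estimates of two different orders: the quadratic one controls small jumps, the
  linear one large jumps.\<close>

lemma norm_iexp_minus_one_minus:
  shows "cmod (iexp s - 1 - \<i> * s) \<le> s\<^sup>2 / 2"
    and "cmod (iexp s - 1 - \<i> * s) \<le> 2 * \<bar>s\<bar>"
  using iexp_approx1[of s 1] iexp_approx2[of s 1]
  by (simp_all add: power2_eq_square algebra_simps flip: abs_mult)

lemma lborel_integral_affine: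
  fixes f :: "'a::euclidean_space \<Rightarrow> 'b::{banach, second_countable_topology}"
  assumes "c \<noteq> 0" and "f \<in> borel_measurable borel"
  shows "integral\<^sup>L lborel f = \<bar>c\<bar> ^ DIM('a) *\<^sub>R (\<integral>x. f (t + c *\<^sub>R x) \<partial>lborel)"
    and "integrable lborel f \<Longrightarrow> integrable lborel (\<lambda>x. f (t + c *\<^sub>R x))"
proof -
  show "integral\<^sup>L lborel f = \<bar>c\<bar> ^ DIM('a) *\<^sub>R (\<integral>x. f (t + c *\<^sub>R x) \<partial>lborel)"
    using assms by (subst lborel_affine[of c t]) (auto simp: integral_density integral_distr)
  assume "integrable lborel f"
  then have "integrable lborel (\<lambda>x. \<bar>c\<bar> ^ DIM('a) *\<^sub>R f (t + c *\<^sub>R x))"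
    using assms
    by (subst (asm) lborel_affine[of c t]) (auto simp: integrable_density integrable_distr_eq)
  from integrable_scaleR_right[OF this, of "inverse (\<bar>c\<bar> ^ DIM('a))"]
  show "integrable lborel (\<lambda>x. f (t + c *\<^sub>R x))"
    using assms by simp
qed

text \<open>\<open>lborel\<close> is the image of the product of one-dimensional Lebesgue measures
  under the map from coordinates to vectors, so the Fubini theorem for finite products
  applies.\<close>

lemma
  fixes f :: "'a::euclidean_space \<Rightarrow> real \<Rightarrow> 'b::{real_normed_field, banach, second_countable_topology}"
  assumes "\<And>b. b \<in> Basis \<Longrightarrow> integrable lborel (f b)"
  shows integrable_lborel_prod: "integrable lborel (\<lambda>x. \<Prod>b\<in>Basis. f b (x \<bullet> b))"
    and integral_lborel_prod:
      "(\<integral>x. (\<Prod>b\<in>Basis. f b (x \<bullet> b)) \<partial>lborel) = (\<Prod>b\<in>Basis. integral\<^sup>L lborel (f b))"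
proof -
  interpret product_sigma_finite "\<lambda>_::'a. lborel :: real measure" by standard
  let ?\<Pi> = "\<Pi>\<^sub>M b\<in>(Basis::'a set). (lborel :: real measure)"
  have [measurable]: "f b \<in> borel_measurable borel" if "b \<in> Basis" for b
    using assms[OF that] by auto
  have eq: "(\<Prod>b\<in>Basis. f b ((\<Sum>b\<in>Basis. z b *\<^sub>R b) \<bullet> b)) = (\<Prod>b\<in>Basis. f b (z b))" for z
    by (intro prod.cong refl) (simp add: inner_sum_left inner_Basis if_distrib cong: if_cong)
  have m: "(\<lambda>x. \<Prod>b\<in>Basis. f b (x \<bullet> b)) \<in> borel_measurable borel"
    by measurable
  have m': "(\<lambda>z. \<Sum>b\<in>Basis. z b *\<^sub>R b) \<in> ?\<Pi> \<rightarrow>\<^sub>M (borel :: 'a measure)"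
    by measurable
  show "integrable lborel (\<lambda>x. \<Prod>b\<in>Basis. f b (x \<bullet> b))"
    unfolding lborel_eq[where ?'a = 'a] using product_integrable_prod[OF finite_Basis assms]
    by (subst integrable_distr_eq[OF m' m]) (simp add: eq)
  show "(\<integral>x. (\<Prod>b\<in>Basis. f b (x \<bullet> b)) \<partial>lborel) = (\<Prod>b\<in>Basis. integral\<^sup>L lborel (f b))"
    unfolding lborel_eq[where ?'a = 'a]
    using product_integral_prod[OF finite_Basis assms] 
    by (subst integral_distr[OF m' m]) (simp add: eq)
qed

text \<open>Each factor 1 + (x.b)^2 is at most 1 + |x|^2, so a product of one-dimensional Cauchy
  densities is a majorant. The generous exponent \<open>DIM('a)\<close> makes this comparison
  possible without polar coordinates.\<close>

lemma integrable_lborel_weight: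
  "integrable lborel (\<lambda>x::'a::euclidean_space. 1 / (1 + (norm x)\<^sup>2) ^ DIM('a))"
proof -
  have 1: "integrable lborel (\<lambda>x::real. 1 / (1 + x\<^sup>2))"
    using integrable_inverse_1_plus_square
    by (simp add: set_integrable_def interval_lebesgue_integrable_def einterval_eq_UNIV inverse_eq_divide)
  have "integrable lborel (\<lambda>x::'a. \<Prod>b\<in>(Basis::'a set). 1 / (1 + (x \<bullet> b)\<^sup>2))"
    by (intro integrable_lborel_prod 1)
  then show ?thesis
  proof (rule Bochner_Integration.integrable_bound)
    show "AE x in lborel. norm (1 / (1 + (norm (x::'a))\<^sup>2) ^ DIM('a))
        \<le> norm (\<Prod>b\<in>(Basis::'a set). 1 / (1 + (x \<bullet> b)\<^sup>2))"
    proof (rule AE_I2)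
      fix x :: 'a
      have "(\<Prod>b\<in>(Basis::'a set). 1 + (x \<bullet> b)\<^sup>2) \<le> (\<Prod>b\<in>(Basis::'a set). 1 + (norm x)\<^sup>2)"
        by (intro prod_mono) (auto simp: abs_le_square_iff[symmetric] Basis_le_norm)
      then have *: "(\<Prod>b\<in>(Basis::'a set). 1 + (x \<bullet> b)\<^sup>2) \<le> (1 + (norm x)\<^sup>2) ^ DIM('a)"
        by simp
      have pos: "0 < (\<Prod>b\<in>(Basis::'a set). 1 + (x \<bullet> b)\<^sup>2)"
        by (intro prod_pos) (auto simp: add_pos_nonneg)
      show "norm (1 / (1 + (norm x)\<^sup>2) ^ DIM('a)) \<le> norm (\<Prod>b\<in>(Basis::'a set). 1 / (1 + (x \<bullet> b)\<^sup>2))"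
        using pos * by (auto simp: prod_dividef intro!: divide_left_mono mult_pos_pos)
    qed
  qed measurable
qed

section \<open>Fourier inversion\<close>

abbreviation gauss :: "'a::euclidean_space \<Rightarrow> real" where
  "gauss x \<equiv> exp (- (norm x)\<^sup>2 / 2)"

text \<open>Up to the normalisation sqrt(2 pi), this is the characteristic function of the standard
  normal distribution.\<close>

lemma
  shows integrable_gauss_real: "integrable lborel (\<lambda>x::real. exp (- x\<^sup>2 / 2))"
    and integral_iexp_gauss_real:
      "(\<integral>x. iexp (t * x) * exp (- x\<^sup>2 / 2) \<partial>lborel) = sqrt (2 * pi) * exp (- t\<^sup>2 / 2)"
proof -
  have eq: "exp (- x\<^sup>2 / 2) = sqrt (2 * pi) * std_normal_density x" for x
    by (simp add: std_normal_density_def)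
  show "integrable lborel (\<lambda>x::real. exp (- x\<^sup>2 / 2))"
    unfolding eq by (intro integrable_mult_right integrable_normal_density) simp
  have "(CLINT x|std_normal_distribution. iexp (t * x)) = exp (- t\<^sup>2 / 2)"
    using fun_cong[OF char_std_normal_distribution, of t] by (simp add: char_def)
  then have "(\<integral>x. std_normal_density x *\<^sub>R iexp (t * x) \<partial>lborel) = exp (- t\<^sup>2 / 2)"
    by (subst (asm) integral_density) (auto simp: normal_density_nonneg)
  moreover have "(\<integral>x. iexp (t * x) * exp (- x\<^sup>2 / 2) \<partial>lborel)
      = (\<integral>x. sqrt (2 * pi) *\<^sub>R (std_normal_density x *\<^sub>R iexp (t * x)) \<partial>lborel)"
    unfolding eq by (intro Bochner_Integration.integral_cong) (auto simp: scaleR_conv_of_real)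
  ultimately show "(\<integral>x. iexp (t * x) * exp (- x\<^sup>2 / 2) \<partial>lborel) = sqrt (2 * pi) * exp (- t\<^sup>2 / 2)"
    by (simp add: scaleR_conv_of_real)
qed

lemma gauss_prod: "gauss x = (\<Prod>b\<in>Basis. exp (- (x \<bullet> b)\<^sup>2 / 2))"
  unfolding exp_sum[OF finite_Basis, symmetric]
  by (simp add: norm_eq_sqrt_inner euclidean_inner[of x x] power2_eq_square sum_negf sum_nonneg
      flip: sum_divide_distrib)

lemma integrable_gauss: "integrable lborel (gauss :: 'a::euclidean_space \<Rightarrow> real)"
  unfolding gauss_prod by (intro integrable_lborel_prod integrable_gauss_real)

lemma integral_iexp_gauss:
  fixes y :: "'a::euclidean_space"
  shows "(\<integral>x. iexp (y \<bullet> x) * gauss x \<partial>lborel) = sqrt (2 * pi) ^ DIM('a) * gauss y"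
proof -
  have eq: "iexp (y \<bullet> x) * gauss x
      = (\<Prod>b\<in>Basis. iexp ((y \<bullet> b) * (x \<bullet> b)) * exp (- (x \<bullet> b)\<^sup>2 / 2))" for x
    by (simp only: gauss_prod prod.distrib euclidean_inner[of y x] of_real_sum sum_distrib_left
        exp_sum[OF finite_Basis] of_real_prod)
  have int: "integrable lborel (\<lambda>x::real. iexp (t * x) * exp (- x\<^sup>2 / 2))" for t
    by (rule Bochner_Integration.integrable_bound[OF integrable_gauss_real]) (auto simp: norm_mult)
  have "(\<integral>x. iexp (y \<bullet> x) * gauss x \<partial>lborel)
      = (\<Prod>b\<in>(Basis::'a set). \<integral>x. iexp ((y \<bullet> b) * x) * exp (- x\<^sup>2 / 2) \<partial>lborel)"
    unfolding eq by (intro integral_lborel_prod int)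
  also have "\<dots> = (\<Prod>b\<in>(Basis::'a set). sqrt (2 * pi) * exp (- (y \<bullet> b)\<^sup>2 / 2))"
    unfolding integral_iexp_gauss_real by simp
  also have "\<dots> = sqrt (2 * pi) ^ DIM('a) * gauss y"
    unfolding of_real_prod[symmetric] by (simp only: prod.distrib prod_constant gauss_prod)
  finally show ?thesis .
qed

section \<open>Schwartz functions\<close>

text \<open>The exponents 0 and 2m are combined: with t = |x|^2, (1 + t)^m is at most (2 max(1,
  t))^m, hence at most 2^m (1 + t^m).\<close>

lemma decay_bound:
  fixes f :: "'a::real_normed_vector \<Rightarrow> 'b::real_normed_vector"
  assumes "\<And>n::nat. bounded (range (\<lambda>x. norm x ^ n *\<^sub>R f x))"
  obtains C where "\<And>x. norm (f x) \<le> C / (1 + (norm x)\<^sup>2) ^ m"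
proof -
  obtain C0 C1 where C0: "\<And>x. norm (norm x ^ 0 *\<^sub>R f x) \<le> C0"
      and C1: "\<And>x. norm (norm x ^ (2 * m) *\<^sub>R f x) \<le> C1"
    using assms[of 0] assms[of "2 * m"] by (auto simp: bounded_iff)
  have "norm (f x) \<le> 2 ^ m * (C0 + C1) / (1 + (norm x)\<^sup>2) ^ m" for x
  proof -
    have "(1 + (norm x)\<^sup>2) ^ m \<le> (2 * max 1 ((norm x)\<^sup>2)) ^ m"
      by (intro power_mono) auto
    also have "\<dots> = 2 ^ m * max 1 ((norm x)\<^sup>2) ^ m"
      by (simp add: power_mult_distrib)
    also have "max 1 ((norm x)\<^sup>2) ^ m \<le> 1 + norm x ^ (2 * m)"
      by (auto simp: max_def power_mult)
    finally have "(1 + (norm x)\<^sup>2) ^ m * norm (f x) \<le> 2 ^ m * (1 + norm x ^ (2 * m)) * norm (f x)"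
      by (simp add: mult_right_mono)
    also have "\<dots> = 2 ^ m * (norm (norm x ^ 0 *\<^sub>R f x) + norm (norm x ^ (2 * m) *\<^sub>R f x))"
      by (simp add: algebra_simps)
    also have "\<dots> \<le> 2 ^ m * (C0 + C1)"
      by (intro mult_left_mono add_mono C0 C1) auto
    finally show ?thesis
      by (simp add: pos_le_divide_eq add_pos_nonneg mult.commute)
  qed
  then show ?thesis by (rule that)
qed

text \<open>Decay of order \<open>DIM('a) + n\<close> in 1 + |x|^2 is spent in two portions: n
  powers absorb the weight (1 + |x|)^n, and the remaining ones leave the integrable function of
  \<open>integrable_lborel_weight\<close>.\<close>

lemma integrable_decay:
  fixes f :: "'a::euclidean_space \<Rightarrow> 'b::{banach, second_countable_topology}"
  assumes [measurable]: "f \<in> borel_measurable borel"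
    and "\<And>n::nat. bounded (range (\<lambda>x. norm x ^ n *\<^sub>R f x))"
  shows "integrable lborel (\<lambda>x. (1 + norm x) ^ n * norm (f x))"
proof -
  obtain C where C: "\<And>x. norm (f x) \<le> C / (1 + (norm x)\<^sup>2) ^ (DIM('a) + n)"
    using decay_bound[OF assms(2)] by blast
  have C0: "0 \<le> C"
    using order_trans[OF norm_ge_zero C[of 0]] by simp
  have "norm ((1 + norm x) ^ n * norm (f x)) \<le> norm (2 ^ n * C * (1 / (1 + (norm x)\<^sup>2) ^ DIM('a)))" for x
  proof -
    \<comment> \<open>This comes from (|x| - 1)^2 \<ge> 0.\<close>
    have "1 + norm x \<le> 2 * (1 + (norm x)\<^sup>2)"
      using zero_le_power2[of "norm x - 1"] zero_le_power2[of "norm x"]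
      unfolding power2_diff by (simp add: field_simps; linarith)
    then have "(1 + norm x) ^ n \<le> 2 ^ n * (1 + (norm x)\<^sup>2) ^ n"
      unfolding power_mult_distrib[symmetric] by (intro power_mono) auto
    moreover have pos: "0 < 1 + (norm x)\<^sup>2" by (simp add: add_pos_nonneg)
    ultimately have "(1 + norm x) ^ n * norm (f x)
        \<le> (2 ^ n * (1 + (norm x)\<^sup>2) ^ n) * (C / (1 + (norm x)\<^sup>2) ^ (DIM('a) + n))"
      using C0 by (intro mult_mono C) auto
    also have "\<dots> = 2 ^ n * C * (1 / (1 + (norm x)\<^sup>2) ^ DIM('a))"
      using pos by (simp add: power_add field_simps)
    finally show ?thesis using C0 by simp
  qed
  then show ?thesis
    by (intro Bochner_Integration.integrable_bound
        [OF integrable_mult_right[OF integrable_lborel_weight, of "2 ^ n * C"]]) auto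
qed

lemma iter_partial_append: "iter_partial (bs @ cs) f = iter_partial bs (iter_partial cs f)"
  by (induction bs) auto

lemma schwartz_iter_partial:
  "schwartz f \<Longrightarrow> set bs \<subseteq> Basis \<Longrightarrow> schwartz (iter_partial bs f)"
  unfolding schwartz_def iter_partial_append[symmetric] by auto

lemma
  fixes f :: "'a::euclidean_space \<Rightarrow> real"
  assumes "schwartz f"
  shows schwartz_differentiable: "f differentiable (at x)"
    and schwartz_continuous: "continuous_on S f"
    and schwartz_borel_measurable: "f \<in> borel_measurable borel"
    and schwartz_bounded: "bounded (range f)"
    and schwartz_integrable: "integrable lborel f"
proof -
  \<comment> \<open>The empty multi-index speaks about f itself.\<close>
  have *: "f differentiable (at x)" "bounded (range (\<lambda>x. norm x ^ n * f x))" for x n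
    using assms unfolding schwartz_def by (force dest: spec[of _ "[]"])+
  show "f differentiable (at x)" by (rule *)
  have c: "continuous_on UNIV f"
    by (simp add: continuous_on_eq_continuous_within differentiable_imp_continuous_within *(1))
  then show "continuous_on S f" by (rule continuous_on_subset) auto
  from c show m: "f \<in> borel_measurable borel" by (rule borel_measurable_continuous_onI)
  show "bounded (range f)" using *(2)[of 0] by simp
  have "integrable lborel (\<lambda>x. norm (f x))"
    using integrable_decay[OF m, of 0] *(2) by simp
  then show "integrable lborel f" using m integrable_norm_iff[of f lborel] by simp
qed

lemma schwartz_has_real_derivative_line:
  fixes f :: "'a::euclidean_space \<Rightarrow> real"
  assumes "schwartz f"
  shows "((\<lambda>s. f (x + s *\<^sub>R b)) has_real_derivative iter_partial [b] f (x + s *\<^sub>R b)) (at s)"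
proof -
  have "(f has_derivative frechet_derivative f (at (x + s *\<^sub>R b))) (at (x + s *\<^sub>R b))"
    using schwartz_differentiable[OF assms] frechet_derivative_works by blast
  then have "((\<lambda>s. f (x + s *\<^sub>R b)) has_derivative
      (\<lambda>h. frechet_derivative f (at (x + s *\<^sub>R b)) (h *\<^sub>R b))) (at s)"
    by (rule has_derivative_compose[rotated]) (auto intro!: derivative_eq_intros)
  moreover have "(\<lambda>h. frechet_derivative f (at (x + s *\<^sub>R b)) (h *\<^sub>R b))
      = (*) (iter_partial [b] f (x + s *\<^sub>R b))"
    using linear_frechet_derivative[OF schwartz_differentiable[OF assms]]
    by (auto simp: linear_cmul)
  ultimately show ?thesis
    unfolding has_field_derivative_def by simp
qed

section \<open>Rapid decay of the Fourier transform\<close>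

lemma norm_fourier_le: "cmod (fourier f \<xi>) \<le> (\<integral>x. \<bar>f x\<bar> \<partial>lborel)"
proof -
  have "cmod (fourier f \<xi>) \<le> (\<integral>x. cmod (f x * exp (- (\<i> * complex_of_real (\<xi> \<bullet> x)))) \<partial>lborel)"
    unfolding fourier_def by (rule integral_norm_bound)
  then show ?thesis by (simp add: norm_mult norm_exp_eq_Re)
qed

lemma integrable_wave:
  fixes f :: "'a \<Rightarrow> real"
  assumes "integrable M f" and "\<phi> \<in> borel_measurable M"
  shows "integrable M (\<lambda>x. f x * exp (- (\<i> * complex_of_real (\<phi> x))))"
proof (rule Bochner_Integration.integrable_bound[OF assms(1)])
  show "(\<lambda>x. f x * exp (- (\<i> * complex_of_real (\<phi> x)))) \<in> borel_measurable M"
    using assms by (intro measurable) auto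
qed (auto simp: norm_mult norm_exp_eq_Re)

lemma fourier_translate:
  fixes f :: "'a::euclidean_space \<Rightarrow> real"
  assumes "f \<in> borel_measurable borel"
  shows "fourier (\<lambda>x. f (x + v)) \<xi> = iexp (\<xi> \<bullet> v) * fourier f \<xi>"
proof -
  have [measurable]: "f \<in> borel_measurable borel" by fact
  have "fourier f \<xi> = (\<integral>x. f (v + 1 *\<^sub>R x) * exp (- (\<i> * complex_of_real (\<xi> \<bullet> (v + 1 *\<^sub>R x)))) \<partial>lborel)"
    unfolding fourier_def by (subst lborel_integral_affine(1)[of 1 _ v]) auto
  also have "\<dots> = (\<integral>x. exp (- (\<i> * complex_of_real (\<xi> \<bullet> v))) *
      (f (x + v) * exp (- (\<i> * complex_of_real (\<xi> \<bullet> x)))) \<partial>lborel)"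
    by (intro Bochner_Integration.integral_cong) (auto simp: inner_add_right distrib_left exp_add mult_ac add.commute exp_diff exp_minus divide_simps)
  also have "\<dots> = exp (- (\<i> * complex_of_real (\<xi> \<bullet> v))) * fourier (\<lambda>x. f (x + v)) \<xi>"
    unfolding fourier_def by simp
  finally show ?thesis by (simp add: exp_minus field_simps)
qed

text \<open>
  Integrating \<open>f (x + t b) - f x = \<integral>\<^sub>0\<^sup>t \<partial>\<^sub>b f (x + s b) ds\<close> against a character replaces
  integration by parts; the bound results from \<open>t = \<pi> / \<bar>\<xi> \<bullet> b\<bar>\<close>, for which
  \<open>e\<^bsup>i t \<xi> \<bullet> b\<^esup> - 1 = -2\<close>.
\<close>

lemma fourier_partial_bound:
  fixes f :: "'a::euclidean_space \<Rightarrow> real"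
  assumes f: "schwartz f" and b: "b \<in> Basis"
  shows "\<bar>\<xi> \<bullet> b\<bar> * cmod (fourier f \<xi>) \<le> 2 * cmod (fourier (iter_partial [b] f) \<xi>)"
proof (cases "\<xi> \<bullet> b = 0")
  case False
  define D where "D = iter_partial [b] f"
  have D: "schwartz D"
    unfolding D_def using f b by (intro schwartz_iter_partial) auto
  note [measurable] = schwartz_borel_measurable[OF f] schwartz_borel_measurable[OF D]
  note fi = schwartz_integrable[OF f] and Di = schwartz_integrable[OF D]
  define t where "t = pi / \<bar>\<xi> \<bullet> b\<bar>"
  have t: "0 < t" using False by (simp add: t_def)
  have "iexp (t * (\<xi> \<bullet> b)) = -1"
    using False by (cases "\<xi> \<bullet> b > 0") (auto simp: t_def exp_minus)
  then have eq: "fourier (\<lambda>x. f (x + t *\<^sub>R b)) \<xi> = - fourier f \<xi>"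
    by (subst fourier_translate) auto
  \<comment> \<open>The cutoff to \<open>{0..t}\<close> turns the integral along the segment into
    one over the whole line, so that Fubini applies to a product of Lebesgue measures.\<close>
  define H where "H s x = (indicator {0..t} s * D (x + s *\<^sub>R b)) * exp (- (\<i> * complex_of_real (\<xi> \<bullet> x)))" for s x
  have Hm[measurable]: "(\<lambda>(s, x). H s x) \<in> borel_measurable (lborel \<Otimes>\<^sub>M lborel)"
    unfolding H_def by measurable
  have Dtr: "integrable lborel (\<lambda>x. D (x + s *\<^sub>R b))" "(\<integral>x. \<bar>D (x + s *\<^sub>R b)\<bar> \<partial>lborel) = (\<integral>x. \<bar>D x\<bar> \<partial>lborel)" for s
    using lborel_integral_affine(2)[of 1 D "s *\<^sub>R b"] Di
      lborel_integral_affine(1)[of 1 "\<lambda>x. \<bar>D x\<bar>" "s *\<^sub>R b"]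
    by (simp_all add: add.commute)
  have Hnorm: "norm (H s x) = indicator {0..t} s * \<bar>D (x + s *\<^sub>R b)\<bar>" for s x
    by (simp add: H_def norm_mult norm_exp_eq_Re)
  have Hi: "integrable (lborel \<Otimes>\<^sub>M lborel) (\<lambda>(s, x). H s x)"
  proof (rule lborel_pair.Fubini_integrable[OF Hm])
    have "integrable lborel (indicat_real {0..t})" 
      using t by (intro integrable_real_indicator) (auto simp: emeasure_lborel_Icc_eq)
    then show "integrable lborel (\<lambda>s. \<integral>x. norm (case (s, x) of (s, x) \<Rightarrow> H s x) \<partial>lborel)"
      by (simp add: Hnorm Dtr)
    show "AE s in lborel. integrable lborel (\<lambda>x. case (s, x) of (s, x) \<Rightarrow> H s x)"
    proof (rule AE_I2)
      fix s show "integrable lborel (\<lambda>x. case (s, x) of (s, x) \<Rightarrow> H s x)"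
        unfolding H_def prod.case by (intro integrable_wave) (use Dtr in auto)
    qed
  qed
  have FTC: "f (x + t *\<^sub>R b) - f x = (\<integral>s. indicator {0..t} s * D (x + s *\<^sub>R b) \<partial>lborel)" for x
  proof -
    have "(\<integral>s. indicator {0..t} s *\<^sub>R D (x + s *\<^sub>R b) \<partial>lborel) = f (x + t *\<^sub>R b) - f (x + 0 *\<^sub>R b)"
    proof (rule integral_FTC_atLeastAtMost)
      show "continuous_on {0..t} (\<lambda>s. D (x + s *\<^sub>R b))"
        by (intro continuous_on_compose2[OF schwartz_continuous[OF D, of UNIV]] continuous_intros) auto
      fix s
      have "((\<lambda>s. f (x + s *\<^sub>R b)) has_real_derivative D (x + s *\<^sub>R b)) (at s)"
        unfolding D_def by (rule schwartz_has_real_derivative_line[OF f])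
      then show "((\<lambda>s. f (x + s *\<^sub>R b)) has_vector_derivative D (x + s *\<^sub>R b)) (at s within {0..t})"
        unfolding has_real_derivative_iff_has_vector_derivative by (rule has_vector_derivative_at_within)
    qed (use t in auto)
    then show ?thesis by simp
  qed
  have ftr: "integrable lborel (\<lambda>x. f (x + t *\<^sub>R b))"
    using lborel_integral_affine(2)[of 1 f "t *\<^sub>R b"] fi by (simp add: add.commute)
  have Hx: "(\<integral>x. H s x \<partial>lborel)
      = complex_of_real (indicator {0..t} s) * (iexp (\<xi> \<bullet> (s *\<^sub>R b)) * fourier D \<xi>)" for s
  proof -
    have "(\<integral>x. H s x \<partial>lborel)
        = complex_of_real (indicator {0..t} s) * fourier (\<lambda>x. D (x + s *\<^sub>R b)) \<xi>"
      unfolding H_def of_real_mult mult.assoc fourier_def by (rule integral_mult_right_zero)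
    then show ?thesis by (simp only: fourier_translate[OF schwartz_borel_measurable[OF D]])
  qed
  have "- 2 * fourier f \<xi> = fourier (\<lambda>x. f (x + t *\<^sub>R b)) \<xi> - fourier f \<xi>"
    unfolding eq by simp
  also have "\<dots> = (\<integral>x. (f (x + t *\<^sub>R b) - f x) * exp (- (\<i> * complex_of_real (\<xi> \<bullet> x))) \<partial>lborel)"
    unfolding fourier_def
    by (subst Bochner_Integration.integral_diff[symmetric])
       (auto intro!: integrable_wave fi ftr simp: left_diff_distrib)
  also have "\<dots> = (\<integral>x. \<integral>s. H s x \<partial>lborel \<partial>lborel)"
    by (simp only: FTC H_def integral_mult_left_zero integral_complex_of_real)
  also have "\<dots> = (\<integral>s. \<integral>x. H s x \<partial>lborel \<partial>lborel)"
    by (rule lborel_pair.Fubini_integral[OF Hi])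
  finally have "2 * cmod (fourier f \<xi>) = cmod (\<integral>s. \<integral>x. H s x \<partial>lborel \<partial>lborel)"
    by (metis norm_minus_cancel norm_mult norm_numeral mult_minus_left)
  also have "\<dots> \<le> (\<integral>s. norm (\<integral>x. H s x \<partial>lborel) \<partial>lborel)"
    by (rule integral_norm_bound)
  also have "\<dots> = (\<integral>s. indicator {0..t} s * cmod (fourier D \<xi>) \<partial>lborel)"
    unfolding Hx by (simp add: norm_mult)
  also have "\<dots> = t * cmod (fourier D \<xi>)"
    using t by simp
  finally have "2 * cmod (fourier f \<xi>) \<le> pi / \<bar>\<xi> \<bullet> b\<bar> * cmod (fourier D \<xi>)"
    by (simp add: t_def)
  then have "\<bar>\<xi> \<bullet> b\<bar> * (2 * cmod (fourier f \<xi>)) \<le> pi * cmod (fourier D \<xi>)"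
    using False by (simp add: field_simps)
  \<comment> \<open>Rounding pi up to 4 replaces the constant pi / 2 by 2.\<close>
  also have "\<dots> \<le> 4 * cmod (fourier D \<xi>)"
    using pi_less_4 by (intro mult_right_mono) auto
  finally show ?thesis by (simp add: D_def)
qed auto

text \<open>Differentiating n times in one basis direction gains n powers of that coordinate of
  \<xi>; the induction generalises over f because its hypothesis is applied to the partial
  derivative. A single direction suffices for each \<xi>, since |\<xi>| is at most the dimension
  times the largest coordinate.\<close>

lemma fourier_decay:
  fixes f :: "'a::euclidean_space \<Rightarrow> real"
  assumes f: "schwartz f"
  shows "bounded (range (\<lambda>\<xi>. norm \<xi> ^ n *\<^sub>R fourier f \<xi>))"
proof -
  have 1: "\<exists>C. \<forall>\<xi>. \<bar>\<xi> \<bullet> b\<bar> ^ n * cmod (fourier f \<xi>) \<le> C" if "b \<in> Basis" for b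
    using f
  proof (induction n arbitrary: f)
    case 0
    then show ?case using norm_fourier_le[of f] by auto
  next
    case (Suc n)
    have "schwartz (iter_partial [b] f)"
      using Suc.prems that by (intro schwartz_iter_partial) auto
    then obtain C where C: "\<bar>\<xi> \<bullet> b\<bar> ^ n * cmod (fourier (iter_partial [b] f) \<xi>) \<le> C" for \<xi>
      using Suc.IH by blast
    have "\<bar>\<xi> \<bullet> b\<bar> ^ Suc n * cmod (fourier f \<xi>) \<le> 2 * C" for \<xi>
    proof -
      have "\<bar>\<xi> \<bullet> b\<bar> ^ Suc n * cmod (fourier f \<xi>)
          \<le> \<bar>\<xi> \<bullet> b\<bar> ^ n * (2 * cmod (fourier (iter_partial [b] f) \<xi>))"
        using mult_left_mono[OF fourier_partial_bound[OF Suc.prems that, of \<xi>], of "\<bar>\<xi> \<bullet> b\<bar> ^ n"]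
        by (simp add: mult_ac)
      also have "\<dots> \<le> 2 * C"
        using C[of \<xi>] by simp
      finally show ?thesis .
    qed
    then show ?case by blast
  qed
  then obtain C where C: "\<And>b \<xi>. b \<in> Basis \<Longrightarrow> \<bar>\<xi> \<bullet> b\<bar> ^ n * cmod (fourier f \<xi>) \<le> C b"
    by metis
  have C0: "0 \<le> C b" if "b \<in> Basis" for b
    by (rule order_trans[OF _ C[OF that, of 0]]) simp
  have "norm (norm \<xi> ^ n *\<^sub>R fourier f \<xi>) \<le> real DIM('a) ^ n * (\<Sum>b\<in>(Basis::'a set). C b)" for \<xi>
  proof -
    \<comment> \<open>The direction of the largest coordinate depends on \<xi>, hence the final
      bound by the sum of all \<open>C b\<close>.\<close>
    define m where "m = Max ((\<lambda>b. \<bar>\<xi> \<bullet> b\<bar>) ` Basis)"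
    have "m \<in> (\<lambda>b. \<bar>\<xi> \<bullet> b\<bar>) ` Basis" unfolding m_def by (intro Max_in) auto
    then obtain b where b: "b \<in> Basis" "m = \<bar>\<xi> \<bullet> b\<bar>" by auto
    have "norm \<xi> \<le> (\<Sum>b\<in>Basis. \<bar>\<xi> \<bullet> b\<bar>)" by (rule norm_le_l1)
    also have "\<dots> \<le> of_nat DIM('a) * m"
      by (rule sum_bounded_above) (simp add: m_def)
    finally have "norm \<xi> ^ n \<le> (real DIM('a) * m) ^ n" by (intro power_mono) auto
    then have "norm \<xi> ^ n * cmod (fourier f \<xi>) \<le> real DIM('a) ^ n * (m ^ n * cmod (fourier f \<xi>))"
      by (simp add: power_mult_distrib mult.assoc[symmetric] mult_right_mono)
    also have "\<dots> \<le> real DIM('a) ^ n * C b"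
      unfolding b(2) by (intro mult_left_mono C b) auto
    also have "C b \<le> (\<Sum>b\<in>(Basis::'a set). C b)"
      using C0 by (intro member_le_sum b) auto
    finally show ?thesis by (simp add: mult_left_mono)
  qed
  then show ?thesis by (auto simp: bounded_iff)
qed

section \<open>The inversion formula\<close>

lemma fourier_borel_measurable:
  assumes "f \<in> borel_measurable borel"
  shows "fourier f \<in> borel_measurable borel"
proof -
  have [measurable]: "f \<in> borel_measurable borel" by fact
  show ?thesis unfolding fourier_def by measurable
qed

text \<open>Gaussian regularisation: after damping by
  \<open>gauss (\<epsilon> n *\<^sub>R \<xi>)\<close> the order of integration may be exchanged, and
  since the Gaussian is its own transform up to a constant, the result is a Gaussian average of f
  near x. As \<epsilon> tends to 0, dominated convergence applies on both sides, by integrability of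
  the transform and by boundedness of f.\<close>

theorem fourier_inversion:
  fixes f :: "'a::euclidean_space \<Rightarrow> real"
  assumes f: "schwartz f"
  shows "(\<integral>\<xi>. fourier f \<xi> * iexp (x \<bullet> \<xi>) \<partial>lborel) = (2 * pi) ^ DIM('a) * complex_of_real (f x)"
proof -
  note [measurable] = schwartz_borel_measurable[OF f] fourier_borel_measurable[OF schwartz_borel_measurable[OF f]]
  note fi = schwartz_integrable[OF f]
  obtain B where B: "\<bar>f y\<bar> \<le> B" for y
    using schwartz_bounded[OF f] by (auto simp: bounded_iff)
  \<comment> \<open>Translation reduces the claim to inversion at the origin: the character becomes
    part of the transform of \<open>h\<close>.\<close>
  define h where "h z = f (x + z)" for z
  have [measurable]: "h \<in> borel_measurable borel" unfolding h_def by measurable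
  have hi: "integrable lborel h"
    using lborel_integral_affine(2)[of 1 f x] fi by (simp add: h_def[abs_def])
  have Fh: "fourier f \<xi> * iexp (x \<bullet> \<xi>) = fourier h \<xi>" for \<xi>
    using fourier_translate[of f x \<xi>] unfolding h_def[abs_def]
    by (simp add: add.commute inner_commute mult.commute)
  have Fi: "integrable lborel (fourier h)"
  proof -
    have "integrable lborel (\<lambda>\<xi>. (1 + norm \<xi>) ^ 0 * norm (fourier f \<xi>))"
      by (intro integrable_decay fourier_decay f) auto
    then have "integrable lborel (fourier f)"
      using integrable_norm_iff[of "fourier f" lborel] by simp
    then show ?thesis
      by (rule Bochner_Integration.integrable_bound)
        (auto simp: Fh[symmetric] norm_mult intro!: fourier_borel_measurable)
  qed
  have [measurable]: "fourier h \<in> borel_measurable borel" by (rule fourier_borel_measurable) simp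
  define \<epsilon> where "\<epsilon> n = 1 / real (Suc n)" for n
  have \<epsilon>: "\<epsilon> n > 0" "\<epsilon> \<longlonglongrightarrow> 0" for n
    unfolding \<epsilon>_def[abs_def] using LIMSEQ_inverse_real_of_nat by (simp_all add: inverse_eq_divide)
  \<comment> \<open>The substitution \<xi> / \<epsilon> for the frequency and the substitution
    \<epsilon> w in space produce the factors \<epsilon>^(-d) and \<epsilon>^d, which
    cancel.\<close>
  have key: "(\<integral>\<xi>. gauss (\<epsilon> n *\<^sub>R \<xi>) *\<^sub>R fourier h \<xi> \<partial>lborel)
      = sqrt (2 * pi) ^ DIM('a) * (\<integral>w. complex_of_real (h (\<epsilon> n *\<^sub>R w)) * gauss w \<partial>lborel)" for n
  proof -
    let ?e = "\<epsilon> n" and ?d = "DIM('a)"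
    have e: "?e > 0" by (rule \<epsilon>)
    define K where "K \<xi> w = gauss \<xi> *\<^sub>R (h (?e *\<^sub>R w) * exp (- (\<i> * complex_of_real (\<xi> \<bullet> w))))" for \<xi> w :: 'a
    have Km: "(\<lambda>(\<xi>, w). K \<xi> w) \<in> borel_measurable (lborel \<Otimes>\<^sub>M lborel)"
      unfolding K_def by measurable
    have he: "integrable lborel (\<lambda>w. h (?e *\<^sub>R w))"
      using lborel_integral_affine(2)[of ?e h 0] hi e by simp
    have Ki: "integrable (lborel \<Otimes>\<^sub>M lborel) (\<lambda>(\<xi>, w). K \<xi> w)"
    proof (rule lborel_pair.Fubini_integrable[OF Km])
      show "integrable lborel (\<lambda>\<xi>. \<integral>w. norm (case (\<xi>, w) of (\<xi>, w) \<Rightarrow> K \<xi> w) \<partial>lborel)"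
        using integrable_gauss[where ?'a = 'a] by (simp add: K_def norm_mult norm_exp_eq_Re)
      show "AE \<xi> in lborel. integrable lborel (\<lambda>w. case (\<xi>, w) of (\<xi>, w) \<Rightarrow> K \<xi> w)"
        unfolding K_def prod.case
        by (intro AE_I2 integrable_scaleR_right integrable_wave he) simp
    qed
    have Fe: "fourier h ((1 / ?e) *\<^sub>R \<xi>)
        = ?e ^ ?d *\<^sub>R (\<integral>w. h (?e *\<^sub>R w) * exp (- (\<i> * complex_of_real (\<xi> \<bullet> w))) \<partial>lborel)" for \<xi>
      using lborel_integral_affine(1)[of ?e
          "\<lambda>w. h w * exp (- (\<i> * complex_of_real (((1 / ?e) *\<^sub>R \<xi>) \<bullet> w)))" 0] e
      by (simp add: fourier_def)
    have Ke: "(\<integral>\<xi>. K \<xi> w \<partial>lborel)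
        = sqrt (2 * pi) ^ ?d * (complex_of_real (h (?e *\<^sub>R w)) * gauss w)" for w
    proof -
      have "(\<integral>\<xi>. K \<xi> w \<partial>lborel) = h (?e *\<^sub>R w) * (\<integral>\<xi>. iexp ((- w) \<bullet> \<xi>) * gauss \<xi> \<partial>lborel)"
        by (subst integral_mult_right_zero[symmetric], intro Bochner_Integration.integral_cong refl)
           (simp add: K_def scaleR_conv_of_real inner_commute mult_ac)
      then show ?thesis
        unfolding integral_iexp_gauss by (simp add: mult_ac)
    qed
    have "(\<integral>\<xi>. gauss (?e *\<^sub>R \<xi>) *\<^sub>R fourier h \<xi> \<partial>lborel)
        = (1 / ?e) ^ ?d *\<^sub>R (\<integral>\<xi>. gauss \<xi> *\<^sub>R fourier h ((1 / ?e) *\<^sub>R \<xi>) \<partial>lborel)"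
      using lborel_integral_affine(1)[of "1 / ?e" "\<lambda>\<xi>. gauss (?e *\<^sub>R \<xi>) *\<^sub>R fourier h \<xi>" 0] e
      by simp
    also have "\<dots> = (\<integral>\<xi>. \<integral>w. K \<xi> w \<partial>lborel \<partial>lborel)"
      unfolding Fe using e
      by (subst integral_scaleR_right[symmetric], intro Bochner_Integration.integral_cong refl)
        (simp add: K_def[abs_def] power_divide)
    also have "\<dots> = (\<integral>w. \<integral>\<xi>. K \<xi> w \<partial>lborel \<partial>lborel)"
      by (rule lborel_pair.Fubini_integral[OF Ki, symmetric])
    finally show ?thesis
      unfolding Ke by simp
  qed
  have lim1: "(\<lambda>n. \<integral>\<xi>. gauss (\<epsilon> n *\<^sub>R \<xi>) *\<^sub>R fourier h \<xi> \<partial>lborel) \<longlonglongrightarrow> (\<integral>\<xi>. fourier h \<xi> \<partial>lborel)"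
  proof (rule integral_dominated_convergence[where w = "\<lambda>\<xi>. norm (fourier h \<xi>)"])
    show "AE \<xi> in lborel. (\<lambda>n. gauss (\<epsilon> n *\<^sub>R \<xi>) *\<^sub>R fourier h \<xi>) \<longlonglongrightarrow> fourier h \<xi>"
      by (intro AE_I2) (auto intro!: tendsto_eq_intros \<epsilon>)
    show "AE \<xi> in lborel. norm (gauss (\<epsilon> n *\<^sub>R \<xi>) *\<^sub>R fourier h \<xi>) \<le> norm (fourier h \<xi>)" for n
      by (intro AE_I2) (auto intro!: mult_left_le_one_le)
  qed (use Fi in auto)
  have lim2: "(\<lambda>n. \<integral>w. complex_of_real (h (\<epsilon> n *\<^sub>R w)) * gauss w \<partial>lborel)
      \<longlonglongrightarrow> (\<integral>w. complex_of_real (h 0) * gauss (w::'a) \<partial>lborel)"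
  proof (rule integral_dominated_convergence[where w = "\<lambda>w::'a. B * gauss w"])
    have c: "continuous_on UNIV f" using f by (rule schwartz_continuous)
    have "(\<lambda>n. h (\<epsilon> n *\<^sub>R w)) \<longlonglongrightarrow> h 0" for w
      unfolding h_def
      by (intro continuous_on_tendsto_compose[OF c]) (auto intro!: tendsto_eq_intros \<epsilon>)
    then show "AE w in lborel. (\<lambda>n. complex_of_real (h (\<epsilon> n *\<^sub>R w)) * gauss w) \<longlonglongrightarrow> complex_of_real (h 0) * gauss w"
      by (intro AE_I2 tendsto_intros)
    show "AE w in lborel. norm (complex_of_real (h (\<epsilon> n *\<^sub>R w)) * gauss w) \<le> B * gauss w" for n
      using B by (intro AE_I2) (auto simp: norm_mult h_def intro!: mult_right_mono)
    show "integrable lborel (\<lambda>w::'a. B * gauss w)"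
      by (intro integrable_mult_right integrable_gauss)
  qed auto
  have "(\<integral>\<xi>. fourier h \<xi> \<partial>lborel)
      = sqrt (2 * pi) ^ DIM('a) * (\<integral>w. complex_of_real (h 0) * gauss (w::'a) \<partial>lborel)"
    using LIMSEQ_unique[OF lim1] tendsto_mult_left[OF lim2, of "sqrt (2 * pi) ^ DIM('a)"]
    unfolding key by blast
  also have "(\<integral>w. complex_of_real (h 0) * gauss (w::'a) \<partial>lborel) = h 0 * sqrt (2 * pi) ^ DIM('a)"
    using integral_iexp_gauss[of "0 :: 'a"] by simp
  finally have "(\<integral>\<xi>. fourier h \<xi> \<partial>lborel)
      = of_real (sqrt (2 * pi) ^ DIM('a) * sqrt (2 * pi) ^ DIM('a)) * complex_of_real (h 0)"
    by simp
  \<comment> \<open>One factor stems from the transform of the Gaussian, the other from its total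
    mass.\<close>
  also have "sqrt (2 * pi) ^ DIM('a) * sqrt (2 * pi) ^ DIM('a) = (2 * pi) ^ DIM('a)"
    unfolding power_mult_distrib[symmetric] by simp
  also have "h 0 = f x" by (simp add: h_def)
  finally show ?thesis
    unfolding Fh by simp
qed

section \<open>The two measures in polar coordinates\<close>

text \<open>Measurability of the inner integral is proved in the same induction as the formula,
  because sums and suprema can be pulled through the integral over \<open>\<sigma>\<close> only for
  measurable integrands.\<close>

lemma nn_integral_polar_measure:
  assumes meas: "\<And>B. B \<in> sets borel \<Longrightarrow>
      (\<lambda>x. emeasure (distr (\<mu> x) borel (\<lambda>r. r *\<^sub>R x)) B) \<in> borel_measurable \<sigma>"
    and H: "H \<in> borel_measurable borel"
  shows "(\<integral>\<^sup>+u. H u \<partial>polar_measure \<sigma> \<mu>) =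
      (\<integral>\<^sup>+x. \<integral>\<^sup>+u. H u \<partial>distr (\<mu> x) borel (\<lambda>r. r *\<^sub>R x) \<partial>\<sigma>)"
proof -
  let ?P = "\<lambda>x. distr (\<mu> x) borel (\<lambda>r. r *\<^sub>R x)"
  from H have "(\<lambda>x. \<integral>\<^sup>+u. H u \<partial>?P x) \<in> borel_measurable \<sigma> \<and>
      (\<integral>\<^sup>+u. H u \<partial>polar_measure \<sigma> \<mu>) = (\<integral>\<^sup>+x. \<integral>\<^sup>+u. H u \<partial>?P x \<partial>\<sigma>)"
  proof (induction rule: borel_measurable_induct)
    case (cong f g)
    then have "f = g" by auto
    with cong show ?case by simp
  next
    case (set A)
    then show ?case by (simp add: emeasure_polar_measure[OF meas] meas)
  next
    case (mult u c)
    then have [measurable]: "(\<lambda>x. \<integral>\<^sup>+u'. u u' \<partial>?P x) \<in> borel_measurable \<sigma>"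
      by blast
    have "(\<lambda>x. c * (\<integral>\<^sup>+u'. u u' \<partial>?P x)) \<in> borel_measurable \<sigma>"
      by measurable
    with mult show ?case by (simp add: nn_integral_cmult)
  next
    case (add u v)
    then have [measurable]: "(\<lambda>x. \<integral>\<^sup>+u'. v u' \<partial>?P x) \<in> borel_measurable \<sigma>"
        "(\<lambda>x. \<integral>\<^sup>+u'. u u' \<partial>?P x) \<in> borel_measurable \<sigma>"
      by blast+
    have "(\<lambda>x. (\<integral>\<^sup>+u'. v u' \<partial>?P x) + (\<integral>\<^sup>+u'. u u' \<partial>?P x)) \<in> borel_measurable \<sigma>"
      by measurable
    with add show ?case by (simp add: nn_integral_add)
  next
    case (seq U)
    have eq: "(\<integral>\<^sup>+u. (SUP i. U i) u \<partial>?P x) = (SUP i. \<integral>\<^sup>+u. U i u \<partial>?P x)" for x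
      unfolding SUP_apply using seq by (intro nn_integral_monotone_convergence_SUP) auto
    have "(\<integral>\<^sup>+u. (SUP i. U i) u \<partial>polar_measure \<sigma> \<mu>) = (SUP i. \<integral>\<^sup>+u. U i u \<partial>polar_measure \<sigma> \<mu>)"
      unfolding SUP_apply using seq by (intro nn_integral_monotone_convergence_SUP) auto
    also have "\<dots> = (SUP i. \<integral>\<^sup>+x. \<integral>\<^sup>+u. U i u \<partial>?P x \<partial>\<sigma>)"
      using seq by simp
    also have "\<dots> = (\<integral>\<^sup>+x. (SUP i. \<integral>\<^sup>+u. U i u \<partial>?P x) \<partial>\<sigma>)"
      using seq
      by (intro nn_integral_monotone_convergence_SUP[symmetric])
         (auto simp: incseq_def le_fun_def intro!: nn_integral_mono)
    finally have "(\<integral>\<^sup>+u. (SUP i. U i) u \<partial>polar_measure \<sigma> \<mu>) = (\<integral>\<^sup>+x. (SUP i. \<integral>\<^sup>+u. U i u \<partial>?P x) \<partial>\<sigma>)" .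
    moreover have "(\<lambda>x. SUP i. \<integral>\<^sup>+u. U i u \<partial>?P x) \<in> borel_measurable \<sigma>"
      using seq by (intro borel_measurable_SUP) auto
    ultimately show ?case
      unfolding eq by blast
  qed
  then show ?thesis by blast
qed

text \<open>Zero at non-positive levels and at levels that \<open>h\<close> does not exceed.\<close>

definition quantile :: "(real \<Rightarrow> real) \<Rightarrow> real \<Rightarrow> real" where
  "quantile h t = (if 0 < t then Sup (insert 0 {s. 0 < s \<and> t < h s}) else 0)"

text \<open>The limit at infinity bounds the set in the supremum. In the equivalence, a level t < h
  a is still exceeded slightly to the right of a by continuity, so the supremum is strictly beyond
  a; the converse is monotonicity. The strict inequalities on both sides are what identifies
  preimages under the quantile.\<close>

lemma
  assumes anti: "antimono_on {0<..} h" and cont: "continuous_on {0<..} h" and lim: "(h \<longlongrightarrow> 0) at_top"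
  shows quantile_nonneg: "0 \<le> quantile h t"
    and less_quantile_iff: "0 < a \<Longrightarrow> a < quantile h t \<longleftrightarrow> 0 < t \<and> t < h a"
proof -
  have bdd: "bdd_above (insert 0 {s. 0 < s \<and> t < h s})" if "0 < t"
  proof -
    have "eventually (\<lambda>s. h s < t) at_top"
      using order_tendstoD(2)[OF lim that] .
    then obtain S where S: "\<And>s. s \<ge> S \<Longrightarrow> h s < t"
      by (auto simp: eventually_at_top_linorder)
    show ?thesis
    proof (rule bdd_aboveI)
      fix s assume "s \<in> insert 0 {s. 0 < s \<and> t < h s}"
      then show "s \<le> max 0 S" using S[of s] by (cases "S \<le> s") auto
    qed
  qed
  show "0 \<le> quantile h t"
    using bdd by (auto simp: quantile_def intro: cSup_upper)
  assume a: "0 < a"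
  show "a < quantile h t \<longleftrightarrow> 0 < t \<and> t < h a"
  proof (cases "0 < t")
    case True
    have "a < quantile h t \<longleftrightarrow> (\<exists>s\<in>insert 0 {s. 0 < s \<and> t < h s}. a < s)"
      using True by (simp add: quantile_def less_cSup_iff[OF _ bdd])
    also have "\<dots> \<longleftrightarrow> (\<exists>s>a. t < h s)"
      using a by auto (metis less_trans)
    also have "\<dots> \<longleftrightarrow> t < h a"
    proof
      assume "\<exists>s>a. t < h s"
      then obtain s where "a < s" "t < h s" by blast
      moreover from this have "h s \<le> h a" using anti a by (auto simp: monotone_on_def)
      ultimately show "t < h a" by simp
    next
      assume "t < h a"
      have "isCont h a" using cont a by (simp add: continuous_on_eq_continuous_at)
      then have "(h \<longlongrightarrow> h a) (at_right a)"
        by (simp add: isCont_def filterlim_at_split)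
      then have "eventually (\<lambda>s. t < h s) (at_right a)"
        using \<open>t < h a\<close> by (rule order_tendstoD)
      then have "eventually (\<lambda>s. t < h s \<and> a < s) (at_right a)"
        by (intro eventually_conj eventually_at_right_less)
      then show "\<exists>s>a. t < h s"
        using eventually_happens[of _ "at_right a"] by force
    qed
    finally show ?thesis using True by simp
  qed (use a in \<open>simp add: quantile_def\<close>)
qed

text \<open>\<open>neg_stieltjes h\<close> carries the sigma-algebra generated by half-open
  intervals within the open half-line. Rays are countable unions of such intervals, so Borel
  functions are measurable for it.\<close>

lemma measurable_neg_stieltjes_id: "(\<lambda>r. r) \<in> borel_measurable (neg_stieltjes h)"
  unfolding borel_measurable_iff_greater
proof
  fix a :: real
  let ?S = "sets (neg_stieltjes h)"
  have Ioc: "{c<..d} \<in> ?S" if "0 < c" "c \<le> d" for c d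
    unfolding sets_neg_stieltjes using that by (intro sigma_sets.Basic) auto
  show "{r \<in> space (neg_stieltjes h). a < r} \<in> ?S"
  proof (cases "0 < a")
    case True
    have "{r \<in> space (neg_stieltjes h). a < r} = (\<Union>n::nat. {a<..a + real n})"
      using True by (auto simp: algebra_simps) (metis add.commute diff_le_eq real_arch_simple)
    also have "\<dots> \<in> ?S"
      using True by (intro sets.countable_UN) (auto intro: Ioc)
    finally show ?thesis .
  next
    case False
    then have "{r \<in> space (neg_stieltjes h). a < r} = space (neg_stieltjes h)" by auto
    then show ?thesis by (metis sets.top)
  qed
qed

text \<open>-dh is the image of Lebesgue measure on levels under the quantile: for positive levels,
  the preimage of (a, b] is [h b, h a), whose length is the mass of (a, b]. Levels with quantile 0
  correspond to no point of the half-line and are removed by the restriction.\<close>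

lemma nn_integral_neg_stieltjes:
  assumes anti: "antimono_on {0<..} h" and cont: "continuous_on {0<..} h" and lim: "(h \<longlongrightarrow> 0) at_top"
    and nonneg: "\<And>r. 0 < r \<Longrightarrow> 0 \<le> h r" and qm: "quantile h \<in> borel_measurable borel"
    and H: "H \<in> borel_measurable borel"
  shows "(\<integral>\<^sup>+r. H r \<partial>neg_stieltjes h) = (\<integral>\<^sup>+t. indicator {0<..} (quantile h t) * H (quantile h t) \<partial>lborel)"
proof -
  note [measurable] = qm H
  note less_iff = less_quantile_iff[OF anti cont lim]
  let ?q = "quantile h" and ?N = "neg_stieltjes h"
  let ?L = "restrict_space lborel {t. 0 < ?q t}"
  let ?E = "(\<lambda>(a, b). {a<..b}) ` {(a, b). 0 < a \<and> a \<le> b} :: real set set"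
  have S: "{t. 0 < ?q t} \<in> sets borel" by measurable
  have pre: "?q -` {a<..b} \<inter> space ?L = {t. 0 < t \<and> h b \<le> t \<and> t < h a}" if "0 < a" "a \<le> b" for a b
  proof -
    have eq: "0 < ?q t \<and> a < ?q t \<and> ?q t \<le> b \<longleftrightarrow> 0 < t \<and> h b \<le> t \<and> t < h a" for t
    proof -
      have "?q t \<le> b \<longleftrightarrow> \<not> (0 < t \<and> t < h b)"
        using less_iff[of b t] that unfolding not_less[symmetric] by simp
      then show ?thesis
        using less_iff[of a t] that by auto
    qed
    have "?q -` {a<..b} \<inter> space ?L = {t. 0 < ?q t \<and> a < ?q t \<and> ?q t \<le> b}"
      by (auto simp: space_restrict_space)
    then show ?thesis by (simp only: eq)
  qed
  have bm: "{t. 0 < t \<and> h b \<le> t \<and> t < h a} \<in> sets borel" for a b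
    by measurable
  have q: "?q \<in> ?L \<rightarrow>\<^sub>M ?N"
  proof (rule measurable_sigma_sets[OF sets_neg_stieltjes])
    show "?q -` y \<inter> space ?L \<in> sets ?L" if y: "y \<in> ?E" for y
    proof -
      obtain a b where ab: "y = {a<..b}" "0 < a" "a \<le> b" using y by auto
      have "0 < ?q t" if "0 < t \<and> h b \<le> t \<and> t < h a" for t
        using less_iff[of a t] ab that by auto
      then show ?thesis
        unfolding ab(1) pre[OF ab(2,3)] using bm S by (subst sets_restrict_space_iff) auto
    qed
  qed (auto simp: space_restrict_space)
  \<comment> \<open>Uniqueness of measures on an intersection-stable generator. The exhausting
    intervals stay away from 0, near which h may be unbounded, and so have finite mass.\<close>
  have "?N = distr ?L ?N ?q"
  proof (rule measure_eqI_generator_eq[where \<Omega> = "{0<..}" and E = ?E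
        and A = "\<lambda>i. {1 / real (Suc i)<..real (Suc i)}"])
    show "Int_stable ?E"
    proof (rule Int_stableI)
      fix A B assume "A \<in> ?E" "B \<in> ?E"
      then obtain a b c d where *: "A = {a<..b}" "0 < a" "a \<le> b" "B = {c<..d}" "0 < c" "c \<le> d" by auto
      \<comment> \<open>The outer \<open>max\<close> keeps the endpoints ordered when the intervals
        are disjoint, so that the empty intersection is also of the required form.\<close>
      then have "A \<inter> B = {max a c<..max (max a c) (min b d)}" by auto
      then show "A \<inter> B \<in> ?E" using * by (auto intro!: image_eqI[of _ _ "(max a c, max (max a c) (min b d))"])
    qed
    have eN: "emeasure ?N {a<..b} = ennreal (h a - h b)" if "0 < a" "a \<le> b" for a b
      using that by (rule emeasure_neg_stieltjes_Ioc[OF anti cont])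
    show "emeasure ?N X = emeasure (distr ?L ?N ?q) X" if XE: "X \<in> ?E" for X
    proof -
      obtain a b where ab: "X = {a<..b}" "0 < a" "a \<le> b" using XE by auto
      have X: "X \<in> sets ?N" unfolding sets_neg_stieltjes using XE by (rule sigma_sets.Basic)
      have hab: "0 \<le> h b" "h b \<le> h a" using nonneg ab anti by (auto simp: monotone_on_def)
      have "emeasure (distr ?L ?N ?q) X = emeasure ?L {t. 0 < t \<and> h b \<le> t \<and> t < h a}"
        by (simp only: emeasure_distr[OF q X] pre[OF ab(2,3), folded ab(1)])
      also have "\<dots> = emeasure lborel {t. 0 < t \<and> h b \<le> t \<and> t < h a}"
        using less_iff[of a] ab S by (intro emeasure_restrict_space) (auto intro: less_trans[OF ab(2)])
      \<comment> \<open>Level 0 is excluded, so the interval is open on the left precisely when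
        \<open>h b\<close> vanishes; its length is the same in either case.\<close>
      also have "{t. 0 < t \<and> h b \<le> t \<and> t < h a} = (if h b = 0 then {0<..<h a} else {h b..<h a})"
        using hab by auto
      also have "emeasure lborel \<dots> = ennreal (h a - h b)"
        using hab by auto
      finally show ?thesis using eN ab by simp
    qed
    show "(\<Union>i. {1 / real (Suc i)<..real (Suc i)}) = {0<..}"
    proof (intro equalityI subsetI)
      fix r :: real assume "r \<in> {0<..}"
      then have r: "0 < r" by simp
      obtain m :: nat where m: "1 / real (Suc m) < r" using nat_approx_posE[OF r] by blast
      obtain n :: nat where n: "r \<le> real n" using real_arch_simple by blast
      have "1 / real (Suc (max m n)) \<le> 1 / real (Suc m)"
        by (intro divide_left_mono) auto
      then show "r \<in> (\<Union>i. {1 / real (Suc i)<..real (Suc i)})"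
        using m n by (intro UN_I[of "max m n"]) auto
    next
      fix r :: real assume "r \<in> (\<Union>i. {1 / real (Suc i)<..real (Suc i)})"
      then obtain i where "1 / real (Suc i) < r" by auto
      moreover have "0 < 1 / real (Suc i)" by simp
      ultimately show "r \<in> {0<..}" unfolding greaterThan_iff by (rule less_trans[rotated])
    qed
    show "range (\<lambda>i. {1 / real (Suc i)<..real (Suc i)}) \<subseteq> ?E"
    proof (rule image_subsetI)
      fix i show "{1 / real (Suc i)<..real (Suc i)} \<in> ?E"
        by (rule image_eqI[of _ _ "(1 / real (Suc i), real (Suc i))"]) (auto simp: field_simps)
    qed
    show "emeasure ?N {1 / real (Suc i)<..real (Suc i)} \<noteq> \<infinity>" for i
      by (subst eN) (auto simp: field_simps)
  qed (auto simp: sets_neg_stieltjes)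
  then have "(\<integral>\<^sup>+r. H r \<partial>?N) = (\<integral>\<^sup>+r. H r \<partial>distr ?L ?N ?q)" by simp
  also have "\<dots> = (\<integral>\<^sup>+t. H (?q t) \<partial>?L)"
    by (rule nn_integral_distr[OF q]) (simp add: measurable_compose[OF measurable_neg_stieltjes_id H])
  also have "\<dots> = (\<integral>\<^sup>+t. H (?q t) * indicator {t. 0 < ?q t} t \<partial>lborel)"
    using S by (subst nn_integral_restrict_space) auto
  also have "\<dots> = (\<integral>\<^sup>+t. indicator {0<..} (?q t) * H (?q t) \<partial>lborel)"
    by (intro nn_integral_cong) (auto simp: indicator_def)
  finally show ?thesis .
qed

section \<open>Both polar measures as integrals over directions and levels\<close>

locale polar_levy =
  fixes \<sigma> :: "'a::euclidean_space measure" and k :: "'a \<Rightarrow> real \<Rightarrow> real"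
  assumes sets_\<sigma>: "sets \<sigma> = sets (restrict_space borel (sphere 0 1))"
    and k_nonneg: "\<And>y r. y \<in> sphere 0 1 \<Longrightarrow> r > 0 \<Longrightarrow> k y r \<ge> 0"
    and k_cont: "\<And>y. y \<in> sphere 0 1 \<Longrightarrow> continuous_on {0<..} (k y)"
    and k_anti: "\<And>y. y \<in> sphere 0 1 \<Longrightarrow> antimono_on {0<..} (k y)"
    and k_cont_sphere: "\<And>r. r > 0 \<Longrightarrow> continuous_on (sphere 0 1) (\<lambda>y. k y r)"
    and k_lim: "\<And>y. y \<in> sphere 0 1 \<Longrightarrow> (k y \<longlongrightarrow> 0) at_top"
begin

lemma space_\<sigma>: "space \<sigma> = sphere 0 1"
  using sets_eq_imp_space_eq[OF sets_\<sigma>] by (simp add: space_restrict_space)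

lemma measurable_\<sigma>_id [measurable]: "(\<lambda>y. y) \<in> borel_measurable \<sigma>"
  using measurable_cong_sets[OF sets_\<sigma> refl] measurable_restrict_space1[OF measurable_ident]
  by (auto simp: id_def)

lemmas less_q_iff = less_quantile_iff[OF k_anti k_cont k_lim]

text \<open>For a > 0 the superlevel set is {0 < t < k y a}, which is measurable because
  \<open>k y a\<close> is continuous in y. At a = 0 no such description is available, since the
  hypotheses say nothing about \<open>k y 0\<close>, so that set is exhausted by the thresholds
  \<open>1 / real (Suc n)\<close>.\<close>

lemma borel_measurable_q [measurable]: "(\<lambda>(y, t). quantile (k y) t) \<in> borel_measurable (\<sigma> \<Otimes>\<^sub>M borel)"
  unfolding borel_measurable_iff_greater
proof
  fix a :: real
  let ?S = "\<lambda>a. {w \<in> space (\<sigma> \<Otimes>\<^sub>M (borel :: real measure)). a < (case w of (y, t) \<Rightarrow> quantile (k y) t)}"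
  have pos: "?S a \<in> sets (\<sigma> \<Otimes>\<^sub>M borel)" if a: "0 < a" for a
  proof -
    have "(\<lambda>y. k y a) \<in> borel_measurable (restrict_space borel (sphere 0 1))"
      using k_cont_sphere[OF a] by (rule borel_measurable_continuous_on_restrict)
    then have [measurable]: "(\<lambda>y. k y a) \<in> borel_measurable \<sigma>"
      using measurable_cong_sets[OF sets_\<sigma> refl] by auto
    have "?S a = {w \<in> space (\<sigma> \<Otimes>\<^sub>M borel). 0 < snd w \<and> snd w < k (fst w) a}"
      using less_q_iff[OF _ _ _ a] by (auto simp: space_pair_measure space_\<sigma>)
    also have "\<dots> \<in> sets (\<sigma> \<Otimes>\<^sub>M borel)" by measurable
    finally show ?thesis .
  qed
  consider "0 < a" | "a = 0" | "a < 0" by linarith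
  then show "?S a \<in> sets (\<sigma> \<Otimes>\<^sub>M borel)"
  proof cases
    case 2
    have "?S a = (\<Union>n. ?S (1 / real (Suc n)))"
    proof (intro equalityI subsetI)
      fix w assume w: "w \<in> ?S a"
      then have "0 < (case w of (y, t) \<Rightarrow> quantile (k y) t)" using 2 by simp
      then obtain n where "1 / real (Suc n) < (case w of (y, t) \<Rightarrow> quantile (k y) t)"
        using nat_approx_posE by blast
      with w show "w \<in> (\<Union>n. ?S (1 / real (Suc n)))" by blast
    next
      fix w assume "w \<in> (\<Union>n. ?S (1 / real (Suc n)))"
      then obtain n where w: "w \<in> ?S (1 / real (Suc n))" by blast
      moreover have "0 < 1 / real (Suc n)" by simp
      ultimately have "0 < (case w of (y, t) \<Rightarrow> quantile (k y) t)"
        by (metis (mono_tags, lifting) less_trans mem_Collect_eq)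
      with w show "w \<in> ?S a" using 2 by simp
    qed
    also have "\<dots> \<in> sets (\<sigma> \<Otimes>\<^sub>M borel)"
      by (intro sets.countable_UN image_subsetI pos) simp
    finally show ?thesis .
  next
    case 3
    then have "?S a = space (\<sigma> \<Otimes>\<^sub>M borel)"
      using quantile_nonneg[OF k_anti k_cont k_lim]
      by (force simp: space_pair_measure space_\<sigma> intro: less_le_trans)
    then show ?thesis by (metis sets.top)
  qed (rule pos)
qed

lemma borel_measurable_q':
  assumes "y \<in> sphere 0 1"
  shows "quantile (k y) \<in> borel_measurable borel"
proof -
  have "y \<in> space \<sigma>" using assms by (simp add: space_\<sigma>)
  from measurable_compose[OF measurable_Pair1'[OF this] borel_measurable_q]
  show ?thesis unfolding prod.case .
qed

text \<open>Layer-cake formula: the levels whose quantile exceeds r fill the interval (0, k y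
  r).\<close>

lemma nn_integral_k:
  assumes "y \<in> sphere 0 1" and "0 < r"
  shows "(\<integral>\<^sup>+t. indicator {0<..} (quantile (k y) t - r) \<partial>lborel) = ennreal (k y r)"
proof -
  have "(\<integral>\<^sup>+t. indicator {0<..} (quantile (k y) t - r) \<partial>lborel) = (\<integral>\<^sup>+t. indicator {0<..<k y r} t \<partial>lborel)"
    using less_q_iff assms by (intro nn_integral_cong) (auto simp: indicator_def)
  then show ?thesis using k_nonneg assms by simp
qed

abbreviation \<nu> :: "'a measure" where
  "\<nu> \<equiv> polar_measure \<sigma> (\<lambda>y. density lborel (\<lambda>r. indicator {0<..} r * ennreal (k y r / r)))"

abbreviation \<nu>t :: "'a measure" where
  "\<nu>t \<equiv> polar_measure \<sigma> (\<lambda>y. neg_stieltjes (k y))"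

lemma nn_integral_neg_stieltjes_k:
  assumes y: "y \<in> sphere 0 1" and [measurable]: "H \<in> borel_measurable borel"
  shows "(\<integral>\<^sup>+u. H u \<partial>distr (neg_stieltjes (k y)) borel (\<lambda>r. r *\<^sub>R y)) =
    (\<integral>\<^sup>+t. indicator {0<..} (quantile (k y) t) * H (quantile (k y) t *\<^sub>R y) \<partial>lborel)"
proof -
  have "(\<lambda>r. r *\<^sub>R y) \<in> neg_stieltjes (k y) \<rightarrow>\<^sub>M borel"
    by (rule measurable_compose[OF measurable_neg_stieltjes_id]) measurable
  then have "(\<integral>\<^sup>+u. H u \<partial>distr (neg_stieltjes (k y)) borel (\<lambda>r. r *\<^sub>R y)) = (\<integral>\<^sup>+r. H (r *\<^sub>R y) \<partial>neg_stieltjes (k y))"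
    by (rule nn_integral_distr) simp
  also have "\<dots> = (\<integral>\<^sup>+t. indicator {0<..} (quantile (k y) t) * H (quantile (k y) t *\<^sub>R y) \<partial>lborel)"
    using y by (intro nn_integral_neg_stieltjes k_anti k_cont k_lim k_nonneg borel_measurable_q') auto
  finally show ?thesis .
qed

lemma nn_integral_\<nu>t:
  assumes [measurable]: "H \<in> borel_measurable borel"
  shows "(\<integral>\<^sup>+u. H u \<partial>\<nu>t) =
    (\<integral>\<^sup>+y. \<integral>\<^sup>+t. indicator {0<..} (quantile (k y) t) * H (quantile (k y) t *\<^sub>R y) \<partial>lborel \<partial>\<sigma>)"
proof -
  \<comment> \<open>Measurability in the direction is what makes \<open>polar_measure\<close> take
    the values of its set function; it is inherited from the joint measurability of the
    quantile.\<close>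
  have m: "(\<lambda>y. emeasure (distr (neg_stieltjes (k y)) borel (\<lambda>r. r *\<^sub>R y)) B) \<in> borel_measurable \<sigma>"
    if [measurable]: "B \<in> sets borel" for B
  proof -
    have "emeasure (distr (neg_stieltjes (k y)) borel (\<lambda>r. r *\<^sub>R y)) B
        = (\<integral>\<^sup>+t. indicator {0<..} (quantile (k y) t) * indicator B (quantile (k y) t *\<^sub>R y) \<partial>lborel)"
      if "y \<in> space \<sigma>" for y
      using nn_integral_neg_stieltjes_k[of y "indicator B"] that by (simp add: space_\<sigma>)
    then show ?thesis
      by (subst measurable_cong) (assumption, measurable)
  qed
  have "(\<integral>\<^sup>+u. H u \<partial>\<nu>t) =
      (\<integral>\<^sup>+y. \<integral>\<^sup>+u. H u \<partial>distr (neg_stieltjes (k y)) borel (\<lambda>r. r *\<^sub>R y) \<partial>\<sigma>)"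
    by (rule nn_integral_polar_measure[OF m assms])
  also have "\<dots> = (\<integral>\<^sup>+y. \<integral>\<^sup>+t. indicator {0<..} (quantile (k y) t) * H (quantile (k y) t *\<^sub>R y) \<partial>lborel \<partial>\<sigma>)"
    by (intro nn_integral_cong nn_integral_neg_stieltjes_k) (auto simp: space_\<sigma>)
  finally show ?thesis .
qed

text \<open>Inserting the layer-cake formula for \<open>k y r\<close> and applying Tonelli leaves,
  for each level with quantile q > 0, the integral of dr/r over 0 < r < q. The substitution r = q s
  preserves dr/r and normalises the range to (0, 1).\<close>

lemma nn_integral_density_k:
  assumes y: "y \<in> sphere 0 1" and [measurable]: "H \<in> borel_measurable borel"
  shows "(\<integral>\<^sup>+u. H u \<partial>distr (density lborel (\<lambda>r. indicator {0<..} r * ennreal (k y r / r))) borel (\<lambda>r. r *\<^sub>R y)) =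
    (\<integral>\<^sup>+t. indicator {0<..} (quantile (k y) t) *
      (\<integral>\<^sup>+s. indicator {0<..<1} s * ennreal (1 / s) * H (s *\<^sub>R (quantile (k y) t *\<^sub>R y)) \<partial>lborel) \<partial>lborel)"
proof -
  let ?q = "quantile (k y)"
  note [measurable] = borel_measurable_q'[OF y]
  have eq: "indicator {0<..} r * ennreal (k y r / r)
      = (\<integral>\<^sup>+t. indicator {0<..} r * ennreal (1 / r) * indicator {0<..} (?q t - r) \<partial>lborel)" for r
  proof (cases "0 < r")
    case True
    then show ?thesis
      using nn_integral_k[OF y True] k_nonneg[OF y True]
      by (simp add: nn_integral_cmult flip: ennreal_mult'')
  qed simp
  have m: "(\<lambda>r. indicator {0<..} r * ennreal (k y r / r)) \<in> borel_measurable lborel"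
    unfolding eq by measurable
  have "(\<integral>\<^sup>+u. H u \<partial>distr (density lborel (\<lambda>r. indicator {0<..} r * ennreal (k y r / r))) borel (\<lambda>r. r *\<^sub>R y))
      = (\<integral>\<^sup>+r. indicator {0<..} r * ennreal (k y r / r) * H (r *\<^sub>R y) \<partial>lborel)"
    using m by (subst nn_integral_distr) (auto simp: nn_integral_density)
  also have "\<dots> = (\<integral>\<^sup>+r. \<integral>\<^sup>+t. indicator {0<..} r * ennreal (1 / r) * indicator {0<..} (?q t - r) * H (r *\<^sub>R y) \<partial>lborel \<partial>lborel)"
    unfolding eq by (intro nn_integral_cong nn_integral_multc[symmetric]) measurable
  also have "\<dots> = (\<integral>\<^sup>+t. \<integral>\<^sup>+r. indicator {0<..} r * ennreal (1 / r) * indicator {0<..} (?q t - r) * H (r *\<^sub>R y) \<partial>lborel \<partial>lborel)"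
    by (rule lborel_pair.Fubini') measurable
  also have "\<dots> = (\<integral>\<^sup>+t. indicator {0<..} (?q t) *
      (\<integral>\<^sup>+s. indicator {0<..<1} s * ennreal (1 / s) * H (s *\<^sub>R (?q t *\<^sub>R y)) \<partial>lborel) \<partial>lborel)"
  proof (intro nn_integral_cong)
    fix t :: real
    show "(\<integral>\<^sup>+r. indicator {0<..} r * ennreal (1 / r) * indicator {0<..} (?q t - r) * H (r *\<^sub>R y) \<partial>lborel)
      = indicator {0<..} (?q t) *
        (\<integral>\<^sup>+s. indicator {0<..<1} s * ennreal (1 / s) * H (s *\<^sub>R (?q t *\<^sub>R y)) \<partial>lborel)"
    proof (cases "0 < ?q t")
      case True
      have "(\<integral>\<^sup>+r. indicator {0<..} r * ennreal (1 / r) * indicator {0<..} (?q t - r) * H (r *\<^sub>R y) \<partial>lborel)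
          = ennreal (?q t) * (\<integral>\<^sup>+s. indicator {0<..} (?q t * s) * ennreal (1 / (?q t * s)) *
              indicator {0<..} (?q t - ?q t * s) * H ((?q t * s) *\<^sub>R y) \<partial>lborel)"
        using True by (subst nn_integral_real_affine[of _ "?q t" 0]) auto
      also have "\<dots> = (\<integral>\<^sup>+s. ennreal (?q t) * (indicator {0<..} (?q t * s) * ennreal (1 / (?q t * s)) *
              indicator {0<..} (?q t - ?q t * s) * H ((?q t * s) *\<^sub>R y)) \<partial>lborel)"
        by (intro nn_integral_cmult[symmetric]) measurable
      also have "\<dots> = (\<integral>\<^sup>+s. indicator {0<..<1} s * ennreal (1 / s) * H (s *\<^sub>R (?q t *\<^sub>R y)) \<partial>lborel)"
      proof (intro nn_integral_cong)
        fix s :: real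
        show "ennreal (?q t) * (indicator {0<..} (?q t * s) * ennreal (1 / (?q t * s)) *
              indicator {0<..} (?q t - ?q t * s) * H ((?q t * s) *\<^sub>R y))
            = indicator {0<..<1} s * ennreal (1 / s) * H (s *\<^sub>R (?q t *\<^sub>R y))"
        proof (cases "0 < s \<and> s < 1")
          case s: True
          have "ennreal (?q t) * ennreal (1 / (?q t * s)) = ennreal (1 / s)"
            using s True by (simp flip: ennreal_mult)
          then show ?thesis
            using s True by (simp add: mult.assoc[symmetric] mult.commute[of s])
        next
          case False
          then have "\<not> (0 < ?q t * s \<and> ?q t * s < ?q t)"
            using True by (auto simp: zero_less_mult_iff)
          then show ?thesis using False by (auto simp: indicator_def)
        qed
      qed
      finally show ?thesis using True by simp
    next
      case False
      then have "(\<integral>\<^sup>+r. indicator {0<..} r * ennreal (1 / r) * indicator {0<..} (?q t - r) * H (r *\<^sub>R y) \<partial>lborel)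
          = (\<integral>\<^sup>+r. 0 \<partial>(lborel :: real measure))"
        by (intro nn_integral_cong) (auto simp: indicator_def)
      with False show ?thesis by simp
    qed
  qed
  finally show ?thesis .
qed

text \<open>Integration of the identity on each ray over all directions; direction and level are
  then reassembled into \<open>\<nu>t\<close>.\<close>

lemma nn_integral_\<nu>:
  assumes [measurable]: "H \<in> borel_measurable borel"
  shows "(\<integral>\<^sup>+u. H u \<partial>\<nu>) =
    (\<integral>\<^sup>+v. \<integral>\<^sup>+s. indicator {0<..<1} s * ennreal (1 / s) * H (s *\<^sub>R v) \<partial>lborel \<partial>\<nu>t)"
proof -
  let ?D = "\<lambda>y. distr (density lborel (\<lambda>r. indicator {0<..} r * ennreal (k y r / r))) borel (\<lambda>r. r *\<^sub>R y)"
  let ?I = "\<lambda>H y. \<integral>\<^sup>+t. indicator {0<..} (quantile (k y) t) *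
      (\<integral>\<^sup>+s. indicator {0<..<1} s * ennreal (1 / s) * H (s *\<^sub>R (quantile (k y) t *\<^sub>R y)) \<partial>lborel) \<partial>lborel"
  have m: "(\<lambda>y. emeasure (?D y) B) \<in> borel_measurable \<sigma>" if [measurable]: "B \<in> sets borel" for B
  proof -
    have "emeasure (?D y) B = ?I (indicator B) y" if "y \<in> space \<sigma>" for y
      using nn_integral_density_k[of y "indicator B"] that by (simp add: space_\<sigma>)
    then show ?thesis
      by (subst measurable_cong) (assumption, measurable)
  qed
  have "(\<integral>\<^sup>+u. H u \<partial>\<nu>) = (\<integral>\<^sup>+y. \<integral>\<^sup>+u. H u \<partial>?D y \<partial>\<sigma>)"
    by (rule nn_integral_polar_measure[OF m assms])
  also have "\<dots> = (\<integral>\<^sup>+y. ?I H y \<partial>\<sigma>)"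
    by (intro nn_integral_cong nn_integral_density_k) (auto simp: space_\<sigma>)
  also have "\<dots> = (\<integral>\<^sup>+v. \<integral>\<^sup>+s. indicator {0<..<1} s * ennreal (1 / s) * H (s *\<^sub>R v) \<partial>lborel \<partial>\<nu>t)"
    by (rule nn_integral_\<nu>t[symmetric]) measurable
  finally show ?thesis .
qed

lemma emeasure_\<nu>t_0: "emeasure \<nu>t {0} = 0"
proof -
  have "emeasure \<nu>t {0} = (\<integral>\<^sup>+u. indicator {0} u \<partial>\<nu>t)"
    by simp
  also have "\<dots> = (\<integral>\<^sup>+y. \<integral>\<^sup>+t. indicator {0<..} (quantile (k y) t) * indicator {0} (quantile (k y) t *\<^sub>R y) \<partial>lborel \<partial>\<sigma>)"
    by (rule nn_integral_\<nu>t) measurable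
  also have "\<dots> = (\<integral>\<^sup>+y. \<integral>\<^sup>+t. 0 \<partial>(lborel :: real measure) \<partial>\<sigma>)"
    by (intro nn_integral_cong) (auto simp: indicator_def space_\<sigma>)
  finally show ?thesis by simp
qed

end

section \<open>Superpositions of plane waves\<close>

text \<open>A non-integrable \<open>f\<close> has integral 0 by convention, and then the bound holds
  because \<open>g\<close> is nonnegative.\<close>

lemma norm_integral_le:
  fixes f :: "'w \<Rightarrow> 'b::{banach, second_countable_topology}"
  assumes "integrable M g" and "\<And>x. norm (f x) \<le> g x"
  shows "norm (integral\<^sup>L M f) \<le> integral\<^sup>L M g"
proof -
  have "norm (integral\<^sup>L M f) \<le> (\<integral>x. norm (f x) \<partial>M)"
    by (rule integral_norm_bound)
  also have "\<dots> \<le> integral\<^sup>L M g"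
    using assms order_trans[OF norm_ge_zero assms(2)] by (intro integral_mono') auto
  finally show ?thesis .
qed

lemma has_derivative_quadratic:
  fixes f :: "'a::real_normed_vector \<Rightarrow> 'b::real_normed_vector"
  assumes "bounded_linear L" and bound: "\<And>v. norm (f (x + v) - f x - L v) \<le> K * (norm v)\<^sup>2"
  shows "(f has_derivative L) (at x)"
  unfolding has_derivative_at
proof
  show "(\<lambda>v. norm (f (x + v) - f x - L v) / norm v) \<midarrow>0\<rightarrow> 0"
  proof (rule Lim_null_comparison)
    show "eventually (\<lambda>v. norm (norm (f (x + v) - f x - L v) / norm v) \<le> K * norm v) (at 0)"
      using bound
      by (intro eventually_at_filter[THEN iffD2] always_eventually)
        (auto simp: field_simps power2_eq_square)
    show "(\<lambda>v. K * norm v) \<midarrow>0\<rightarrow> 0"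
      by (auto intro!: tendsto_eq_intros)
  qed
qed fact

lemma grad_eqI:
  assumes "GDERIV f x :> D"
  shows "grad f x = D"
  unfolding grad_def
proof (rule the_equality[where P = "\<lambda>D. GDERIV f x :> D"])
  fix E assume "GDERIV f x :> E"
  then have "(\<lambda>v. v \<bullet> E) = (\<lambda>v. v \<bullet> D)"
    using assms unfolding gderiv_def by (rule has_derivative_unique)
  then have "v \<bullet> E = v \<bullet> D" for v by (rule fun_cong)
  then show "E = D" by (subst vector_eq_ldot[symmetric]) simp
qed fact

text \<open>The index space is kept abstract so that the same results serve functions given by a
  density in one frequency and carre du champs given by a density in pairs of frequencies. The
  second moment pays both for the Taylor remainder in the derivative and for the quadratic growth of
  the symbol of the jump part.\<close>

locale wave =
  fixes m :: "'w measure" and c :: "'w \<Rightarrow> complex" and \<phi> :: "'w \<Rightarrow> 'a::euclidean_space"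
    and h :: "'a \<Rightarrow> real"
  assumes m: "sigma_finite_measure m"
    and c_meas [measurable]: "c \<in> borel_measurable m"
    and \<phi>_meas [measurable]: "\<phi> \<in> borel_measurable m"
    and moment: "integrable m (\<lambda>\<omega>. (1 + norm (\<phi> \<omega>))\<^sup>2 * cmod (c \<omega>))"
    and h_eq: "\<And>x. complex_of_real (h x) = (\<integral>\<omega>. c \<omega> * iexp (x \<bullet> \<phi> \<omega>) \<partial>m)"
begin

lemma integrable_bounded:
  assumes [measurable]: "p \<in> borel_measurable m"
    and bound: "\<And>\<omega>. cmod (p \<omega>) \<le> C * (1 + norm (\<phi> \<omega>))\<^sup>2"
  shows "integrable m (\<lambda>\<omega>. c \<omega> * p \<omega>)"
proof (rule Bochner_Integration.integrable_bound[OF integrable_mult_right[OF moment, of C]])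
  show "AE \<omega> in m. norm (c \<omega> * p \<omega>) \<le> norm (C * ((1 + norm (\<phi> \<omega>))\<^sup>2 * cmod (c \<omega>)))"
  proof (rule AE_I2)
    fix \<omega>
    have "norm (c \<omega> * p \<omega>) \<le> cmod (c \<omega>) * (C * (1 + norm (\<phi> \<omega>))\<^sup>2)"
      unfolding norm_mult by (intro mult_left_mono bound) simp
    also have "\<dots> = C * ((1 + norm (\<phi> \<omega>))\<^sup>2 * cmod (c \<omega>))" by simp
    finally show "norm (c \<omega> * p \<omega>) \<le> norm (C * ((1 + norm (\<phi> \<omega>))\<^sup>2 * cmod (c \<omega>)))" by simp
  qed
qed measurable

lemma \<phi>_bounds: "norm (\<phi> \<omega>) \<le> (1 + norm (\<phi> \<omega>))\<^sup>2" "1 \<le> (1 + norm (\<phi> \<omega>))\<^sup>2"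
    "(norm (\<phi> \<omega>))\<^sup>2 \<le> (1 + norm (\<phi> \<omega>))\<^sup>2"
  by (auto simp: power2_eq_square algebra_simps)

lemma integrable_wave0: "integrable m (\<lambda>\<omega>. c \<omega> * iexp (x \<bullet> \<phi> \<omega>))"
  by (rule integrable_bounded[where C = 1]) (simp_all add: \<phi>_bounds)

lemma integrable_wave1: "integrable m (\<lambda>\<omega>. c \<omega> * (\<i> * (v \<bullet> \<phi> \<omega>) * iexp (x \<bullet> \<phi> \<omega>)))"
proof (rule integrable_bounded[where C = "norm v"])
  fix \<omega>
  have "\<bar>v \<bullet> \<phi> \<omega>\<bar> \<le> norm v * norm (\<phi> \<omega>)" by (rule Cauchy_Schwarz_ineq2)
  also have "\<dots> \<le> norm v * (1 + norm (\<phi> \<omega>))\<^sup>2" by (intro mult_left_mono \<phi>_bounds) simp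
  finally show "cmod (\<i> * (v \<bullet> \<phi> \<omega>) * iexp (x \<bullet> \<phi> \<omega>)) \<le> norm v * (1 + norm (\<phi> \<omega>))\<^sup>2"
    by (simp add: norm_mult)
qed measurable

definition "D x v = (\<integral>\<omega>. c \<omega> * (\<i> * (v \<bullet> \<phi> \<omega>) * iexp (x \<bullet> \<phi> \<omega>)) \<partial>m)"

lemma linear_D: "linear (D x)"
proof
  show "D x (v + w) = D x v + D x w" for v w
    unfolding D_def
    by (subst Bochner_Integration.integral_add[OF integrable_wave1 integrable_wave1, symmetric])
       (simp add: inner_add_left algebra_simps)
  show "D x (r *\<^sub>R v) = r *\<^sub>R D x v" for r v
    unfolding D_def
    by (subst integral_scaleR_right[symmetric]) (simp add: scaleR_conv_of_real mult_ac)
qed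

text \<open>The second-order Taylor bound for the exponential, integrated against the density, gives
  a remainder of at most the second moment times |v|^2.\<close>

lemma has_derivative_h: "((\<lambda>x. complex_of_real (h x)) has_derivative D x) (at x)"
proof (rule has_derivative_quadratic)
  show "bounded_linear (D x)" using linear_D by (simp add: linear_conv_bounded_linear)
  fix v
  let ?K = "\<integral>\<omega>. (1 + norm (\<phi> \<omega>))\<^sup>2 * cmod (c \<omega>) \<partial>m"
  have "complex_of_real (h (x + v)) - complex_of_real (h x) - D x v
      = (\<integral>\<omega>. c \<omega> * iexp ((x + v) \<bullet> \<phi> \<omega>) - c \<omega> * iexp (x \<bullet> \<phi> \<omega>)
          - c \<omega> * (\<i> * (v \<bullet> \<phi> \<omega>) * iexp (x \<bullet> \<phi> \<omega>)) \<partial>m)"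
    unfolding h_eq D_def
    by (simp only: Bochner_Integration.integral_diff Bochner_Integration.integrable_diff
        integrable_wave0 integrable_wave1)
  also have "norm \<dots> \<le> (\<integral>\<omega>. (norm v)\<^sup>2 * ((1 + norm (\<phi> \<omega>))\<^sup>2 * cmod (c \<omega>)) \<partial>m)"
  proof (rule norm_integral_le)
    show "integrable m (\<lambda>\<omega>. (norm v)\<^sup>2 * ((1 + norm (\<phi> \<omega>))\<^sup>2 * cmod (c \<omega>)))"
      by (intro integrable_mult_right moment)
    fix \<omega>
    have "c \<omega> * iexp ((x + v) \<bullet> \<phi> \<omega>) - c \<omega> * iexp (x \<bullet> \<phi> \<omega>) - c \<omega> * (\<i> * (v \<bullet> \<phi> \<omega>) * iexp (x \<bullet> \<phi> \<omega>))
        = c \<omega> * iexp (x \<bullet> \<phi> \<omega>) * (iexp (v \<bullet> \<phi> \<omega>) - 1 - \<i> * (v \<bullet> \<phi> \<omega>))"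
      by (simp add: inner_add_left distrib_left exp_add algebra_simps)
    then have n1: "norm (c \<omega> * iexp ((x + v) \<bullet> \<phi> \<omega>) - c \<omega> * iexp (x \<bullet> \<phi> \<omega>)
          - c \<omega> * (\<i> * (v \<bullet> \<phi> \<omega>) * iexp (x \<bullet> \<phi> \<omega>)))
        = cmod (c \<omega>) * cmod (iexp (v \<bullet> \<phi> \<omega>) - 1 - \<i> * (v \<bullet> \<phi> \<omega>))"
      by (simp add: norm_mult)
    have n2: "cmod (iexp (v \<bullet> \<phi> \<omega>) - 1 - \<i> * (v \<bullet> \<phi> \<omega>)) \<le> (norm v)\<^sup>2 * (1 + norm (\<phi> \<omega>))\<^sup>2"
    proof -
      have "cmod (iexp (v \<bullet> \<phi> \<omega>) - 1 - \<i> * (v \<bullet> \<phi> \<omega>)) \<le> (v \<bullet> \<phi> \<omega>)\<^sup>2"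
        using norm_iexp_minus_one_minus(1)[of "v \<bullet> \<phi> \<omega>"] zero_le_power2[of "v \<bullet> \<phi> \<omega>"] by linarith
      also have "\<dots> \<le> (norm v * norm (\<phi> \<omega>))\<^sup>2"
        using Cauchy_Schwarz_ineq2[of v "\<phi> \<omega>"] by (simp add: abs_le_square_iff[symmetric])
      also have "\<dots> \<le> (norm v)\<^sup>2 * (1 + norm (\<phi> \<omega>))\<^sup>2"
        unfolding power_mult_distrib by (intro mult_left_mono \<phi>_bounds) simp
      finally show ?thesis .
    qed
    show "norm (c \<omega> * iexp ((x + v) \<bullet> \<phi> \<omega>) - c \<omega> * iexp (x \<bullet> \<phi> \<omega>)
          - c \<omega> * (\<i> * (v \<bullet> \<phi> \<omega>) * iexp (x \<bullet> \<phi> \<omega>)))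
        \<le> (norm v)\<^sup>2 * ((1 + norm (\<phi> \<omega>))\<^sup>2 * cmod (c \<omega>))"
      unfolding n1 using mult_left_mono[OF n2 norm_ge_zero[of "c \<omega>"]] by (simp only: mult_ac)
  qed
  finally show "norm (complex_of_real (h (x + v)) - complex_of_real (h x) - D x v) \<le> ?K * (norm v)\<^sup>2"
    by (simp add: mult.commute)
qed

text \<open>\<open>D x v\<close> is complex by construction, but h is real: its imaginary part is
  the derivative of the zero function and vanishes. The gradient is then read off from the real
  parts on \<open>Basis\<close>.\<close>

lemma of_real_inner_grad: "complex_of_real (v \<bullet> grad h x) = D x v"
proof -
  have "((\<lambda>x. Im (complex_of_real (h x))) has_derivative (\<lambda>v. Im (D x v))) (at x)"
    by (rule bounded_linear.has_derivative[OF bounded_linear_Im has_derivative_h])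
  moreover have "((\<lambda>x. Im (complex_of_real (h x))) has_derivative (\<lambda>v. 0)) (at x)"
    by simp
  ultimately have "(\<lambda>v. Im (D x v)) = (\<lambda>v. 0)" by (rule has_derivative_unique)
  then have Im: "Im (D x v) = 0" for v by (rule fun_cong)
  define E where "E = (\<Sum>b\<in>Basis. Re (D x b) *\<^sub>R b)"
  have G: "Re (D x v) = v \<bullet> E" for v
  proof -
    have "D x v = D x (\<Sum>b\<in>Basis. (v \<bullet> b) *\<^sub>R b)" by (simp add: euclidean_representation)
    also have "\<dots> = (\<Sum>b\<in>Basis. (v \<bullet> b) *\<^sub>R D x b)"
      by (simp add: linear_sum[OF linear_D] linear_cmul[OF linear_D])
    finally show ?thesis by (simp add: E_def inner_sum_right mult.commute)
  qed
  have "((\<lambda>x. Re (complex_of_real (h x))) has_derivative (\<lambda>v. Re (D x v))) (at x)"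
    by (rule bounded_linear.has_derivative[OF bounded_linear_Re has_derivative_h])
  then have "grad h x = E"
    by (intro grad_eqI) (simp add: gderiv_def G)
  then show ?thesis by (simp add: complex_eq_iff Im G)
qed

end

section \<open>The symbols\<close>

lemma integrable_pair_mult:
  fixes a :: "'m \<Rightarrow> real" and b :: "'n \<Rightarrow> real"
  assumes M: "sigma_finite_measure M" and N: "sigma_finite_measure N"
    and a: "integrable M a" and b: "integrable N b"
  shows "integrable (M \<Otimes>\<^sub>M N) (\<lambda>(x, y). a x * b y)"
proof -
  interpret pair_sigma_finite M N using M N by (rule pair_sigma_finite.intro)
  have [measurable]: "a \<in> borel_measurable M" "b \<in> borel_measurable N"
    using a b by auto
  show ?thesis
  proof (rule Fubini_integrable)
    show "integrable M (\<lambda>x. \<integral>y. norm (case (x, y) of (x, y) \<Rightarrow> a x * b y) \<partial>N)"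
      using a b by (simp add: abs_mult integrable_abs)
    show "AE x in M. integrable N (\<lambda>y. case (x, y) of (x, y) \<Rightarrow> a x * b y)"
      using b by simp
  qed measurable
qed

lemma integrable_pair_bound:
  fixes F :: "'m \<Rightarrow> 'n \<Rightarrow> 'b::{banach, second_countable_topology}"
  assumes "sigma_finite_measure M" and "sigma_finite_measure N"
    and F: "(\<lambda>(x, y). F x y) \<in> borel_measurable (M \<Otimes>\<^sub>M N)"
    and "integrable M a" and "integrable N b"
    and bound: "\<And>x y. norm (F x y) \<le> a x * b y"
  shows "integrable (M \<Otimes>\<^sub>M N) (\<lambda>(x, y). F x y)"
  by (rule Bochner_Integration.integrable_bound[OF integrable_pair_mult[OF assms(1,2,4,5)] F])
     (auto intro!: AE_I2 order_trans[OF bound] simp del: abs_mult)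

text \<open>A common majorant, up to constants depending on the frequencies, of all integrands
  against \<open>\<nu>\<close> and \<open>\<nu>t\<close>: quadratic for small jumps as in the Levy
  condition, linear for large ones as in the first-moment condition.\<close>

definition levy_weight :: "'a::euclidean_space \<Rightarrow> real" where
  "levy_weight u = min (norm u) ((norm u)\<^sup>2)"

lemma levy_weight_nonneg [simp]: "0 \<le> levy_weight u"
  by (simp add: levy_weight_def)

lemma levy_weight_pos: "u \<noteq> 0 \<Longrightarrow> 0 < levy_weight u"
  by (simp add: levy_weight_def)

lemma borel_measurable_levy_weight [measurable]: "levy_weight \<in> borel_measurable borel"
  unfolding levy_weight_def by measurable

lemma levy_weight_scaleR:
  assumes "0 \<le> s" "s \<le> 1"
  shows "s\<^sup>2 * levy_weight v \<le> levy_weight (s *\<^sub>R v)"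
proof -
  have "s\<^sup>2 * levy_weight v \<le> s\<^sup>2 * norm v"
    by (intro mult_left_mono) (auto simp: levy_weight_def)
  also have "\<dots> \<le> s * norm v"
    using assms by (intro mult_right_mono) (auto simp: power2_eq_square mult_left_le)
  finally have "s\<^sup>2 * levy_weight v \<le> norm (s *\<^sub>R v)" using assms by simp
  moreover have "s\<^sup>2 * levy_weight v \<le> (norm (s *\<^sub>R v))\<^sup>2"
    unfolding norm_scaleR power_mult_distrib power2_abs
    by (intro mult_left_mono) (auto simp: levy_weight_def)
  ultimately show ?thesis unfolding levy_weight_def[of "s *\<^sub>R v"] by simp
qed

text \<open>The difference is estimated by 2 for large jumps and by |u.\<xi>| for small ones. The
  dependence on the frequencies is relaxed to a product of powers of 1 + |\<xi>| and 1 + |\<zeta>|,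
  which suits both the moment conditions and Fubini.\<close>

lemma inner_iexp_bound:
  "\<bar>u \<bullet> \<zeta>\<bar> * cmod (iexp (u \<bullet> \<xi>) - 1) \<le> 2 * ((1 + norm \<xi>) * (1 + norm \<zeta>)) * levy_weight u"
proof -
  have a: "\<bar>u \<bullet> \<zeta>\<bar> \<le> norm u * norm \<zeta>" and b: "\<bar>u \<bullet> \<xi>\<bar> \<le> norm u * norm \<xi>"
    by (rule Cauchy_Schwarz_ineq2)+
  have c: "cmod (iexp (u \<bullet> \<xi>) - 1) \<le> 2" "cmod (iexp (u \<bullet> \<xi>) - 1) \<le> norm u * norm \<xi>"
    using norm_iexp_minus_one[of "u \<bullet> \<xi>"] b by auto
  have "\<bar>u \<bullet> \<zeta>\<bar> * cmod (iexp (u \<bullet> \<xi>) - 1) \<le> (norm u * norm \<zeta>) * 2"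
    by (intro mult_mono a c) auto
  also have "\<dots> = (2 * norm \<zeta>) * norm u" by simp
  also have "\<dots> \<le> (2 * ((1 + norm \<xi>) * (1 + norm \<zeta>))) * norm u"
    by (intro mult_right_mono) (auto simp: algebra_simps)
  finally have 1: "\<bar>u \<bullet> \<zeta>\<bar> * cmod (iexp (u \<bullet> \<xi>) - 1) \<le> \<dots>" .
  have "\<bar>u \<bullet> \<zeta>\<bar> * cmod (iexp (u \<bullet> \<xi>) - 1) \<le> (norm u * norm \<zeta>) * (norm u * norm \<xi>)"
    by (intro mult_mono a c) auto
  also have "\<dots> = (norm \<xi> * norm \<zeta>) * (norm u)\<^sup>2" by (simp add: power2_eq_square)
  also have "\<dots> \<le> (2 * ((1 + norm \<xi>) * (1 + norm \<zeta>))) * (norm u)\<^sup>2"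
    by (intro mult_right_mono) (auto simp: algebra_simps)
  finally show ?thesis using 1 by (auto simp: levy_weight_def min_def)
qed

lemma iexp_iexp_bound:
  "cmod ((iexp (u \<bullet> \<xi>) - 1) * (iexp (u \<bullet> \<zeta>) - 1)) \<le> 2 * ((1 + norm \<xi>) * (1 + norm \<zeta>)) * levy_weight u"
proof -
  have "cmod ((iexp (u \<bullet> \<xi>) - 1) * (iexp (u \<bullet> \<zeta>) - 1)) \<le> cmod (iexp (u \<bullet> \<xi>) - 1) * \<bar>u \<bullet> \<zeta>\<bar>"
    unfolding norm_mult using norm_iexp_minus_one[of "u \<bullet> \<zeta>"] by (intro mult_left_mono) auto
  also have "\<dots> \<le> 2 * ((1 + norm \<xi>) * (1 + norm \<zeta>)) * levy_weight u"
    using inner_iexp_bound[of u \<zeta> \<xi>] by (simp add: mult.commute)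
  finally show ?thesis .
qed

lemma iexp_second_order_bound:
  "cmod (iexp (u \<bullet> \<xi>) - 1 - \<i> * (u \<bullet> \<xi>)) \<le> 2 * ((1 + norm \<xi>) * (1 + norm \<xi>)) * levy_weight u"
proof -
  have b: "\<bar>u \<bullet> \<xi>\<bar> \<le> norm u * norm \<xi>"
    by (rule Cauchy_Schwarz_ineq2)
  have "cmod (iexp (u \<bullet> \<xi>) - 1 - \<i> * (u \<bullet> \<xi>)) \<le> 2 * (norm u * norm \<xi>)"
    using norm_iexp_minus_one_minus(2)[of "u \<bullet> \<xi>"] b by linarith
  also have "\<dots> = (2 * norm \<xi>) * norm u" by simp
  also have "\<dots> \<le> (2 * ((1 + norm \<xi>) * (1 + norm \<xi>))) * norm u"
    by (intro mult_right_mono) (auto simp: algebra_simps)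
  finally have 1: "cmod (iexp (u \<bullet> \<xi>) - 1 - \<i> * (u \<bullet> \<xi>)) \<le> \<dots>" .
  have "cmod (iexp (u \<bullet> \<xi>) - 1 - \<i> * (u \<bullet> \<xi>)) \<le> (u \<bullet> \<xi>)\<^sup>2"
    using norm_iexp_minus_one_minus(1)[of "u \<bullet> \<xi>"] zero_le_power2[of "u \<bullet> \<xi>"] by linarith
  also have "\<dots> \<le> (norm u * norm \<xi>)\<^sup>2"
    using b by (simp add: abs_le_square_iff[symmetric])
  also have "\<dots> = (norm \<xi> * norm \<xi>) * (norm u)\<^sup>2" by (simp add: power2_eq_square)
  also have "\<dots> \<le> (2 * ((1 + norm \<xi>) * (1 + norm \<xi>))) * (norm u)\<^sup>2"
    by (intro mult_right_mono) (auto simp: algebra_simps)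
  finally show ?thesis using 1 by (auto simp: levy_weight_def min_def)
qed

text \<open>By the Markov inequality the sets where the weight is at least
  \<open>1 / real (Suc n)\<close> have finite measure; they cover everything except the origin,
  which is null.\<close>

lemma
  assumes sets [measurable_cong]: "sets M = sets borel" and M0: "emeasure M {0} = 0"
    and fin: "(\<integral>\<^sup>+u. ennreal (levy_weight u) \<partial>M) < \<infinity>"
  shows sigma_finite_levy_weight: "sigma_finite_measure M"
    and integrable_levy_weight: "integrable M levy_weight"
proof -
  show "integrable M levy_weight"
    using fin by (intro integrableI_nonneg) auto
  have space: "space M = UNIV" using sets_eq_imp_space_eq[OF sets] by simp
  let ?A = "\<lambda>n::nat. {u \<in> space M. 1 \<le> ennreal (Suc n) * ennreal (levy_weight u)}"
  have A: "emeasure M (?A n) \<noteq> \<infinity>" for n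
  proof -
    have "emeasure M (?A n) \<le> ennreal (Suc n) * (\<integral>\<^sup>+u. ennreal (levy_weight u) * indicator (space M) u \<partial>M)"
      by (rule nn_integral_Markov_inequality) measurable
    also have "(\<integral>\<^sup>+u. ennreal (levy_weight u) * indicator (space M) u \<partial>M) = (\<integral>\<^sup>+u. ennreal (levy_weight u) \<partial>M)"
      by (intro nn_integral_cong) simp
    also have "ennreal (Suc n) * \<dots> < \<infinity>"
      using fin by (simp add: ennreal_mult_less_top)
    finally show ?thesis by simp
  qed
  show "sigma_finite_measure M"
  proof
    show "\<exists>B. countable B \<and> B \<subseteq> sets M \<and> \<Union>B = space M \<and> (\<forall>a\<in>B. emeasure M a \<noteq> \<infinity>)"
    proof (intro exI conjI)
      show "\<Union>(insert {0} (range ?A)) = space M"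
      proof -
        have "u \<in> \<Union>(insert {0} (range ?A))" for u
        proof (cases "u = 0")
          case False
          then obtain n where "1 / real (Suc n) < levy_weight u"
            using nat_approx_posE[OF levy_weight_pos] by blast
          then have "1 \<le> real (Suc n) * levy_weight u"
            by (simp add: field_simps)
          then have "ennreal 1 \<le> ennreal (Suc n * levy_weight u)"
            by (rule ennreal_leI)
          also have "\<dots> = ennreal (Suc n) * ennreal (levy_weight u)"
            by (rule ennreal_mult) auto
          finally have "1 \<le> ennreal (Suc n) * ennreal (levy_weight u)"
            by simp
          then show ?thesis using space by auto
        qed simp
        then show ?thesis using space by blast
      qed
      show "insert {0} (range ?A) \<subseteq> sets M"
        by (auto simp: sets)
      show "\<forall>a\<in>insert {0} (range ?A). emeasure M a \<noteq> \<infinity>"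
        using A M0 by auto
    qed auto
  qed
qed

text \<open>All that is retained of the polar coordinates: null origin, integrability of the weight
  for \<open>\<nu>\<close>, and the scaling identity between the two measures.\<close>

locale levy_pair =
  fixes \<nu> \<nu>t :: "'a::euclidean_space measure"
  assumes sets_\<nu> [measurable_cong]: "sets \<nu> = sets borel"
    and sets_\<nu>t [measurable_cong]: "sets \<nu>t = sets borel"
    and \<nu>_0: "emeasure \<nu> {0} = 0" and \<nu>t_0: "emeasure \<nu>t {0} = 0"
    and \<nu>_weight: "(\<integral>\<^sup>+u. ennreal (levy_weight u) \<partial>\<nu>) < \<infinity>"
    and nn_integral_scaling: "\<And>H. H \<in> borel_measurable borel \<Longrightarrow> (\<integral>\<^sup>+u. H u \<partial>\<nu>) =
      (\<integral>\<^sup>+v. \<integral>\<^sup>+s. indicator {0<..<1} s * ennreal (1 / s) * H (s *\<^sub>R v) \<partial>lborel \<partial>\<nu>t)"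
begin

text \<open>Only s in (1/2, 1) is kept in the scaling identity. There the integrand
  \<open>levy_weight (s *\<^sub>R v) / s\<close> is at least s times the weight of v, hence at least
  half of it; with the interval length 1/2 this gives the constant 1/4.\<close>

lemma \<nu>t_weight: "(\<integral>\<^sup>+u. ennreal (levy_weight u) \<partial>\<nu>t) < \<infinity>"
proof -
  have "(\<integral>\<^sup>+v. ennreal (1 / 4) * ennreal (levy_weight v) \<partial>\<nu>t) \<le> (\<integral>\<^sup>+u. ennreal (levy_weight u) \<partial>\<nu>)"
    unfolding nn_integral_scaling[OF measurable_compose[OF borel_measurable_levy_weight measurable_ennreal]]
  proof (rule nn_integral_mono)
    fix v :: 'a
    have "ennreal (1 / 4) * ennreal (levy_weight v) = ennreal (levy_weight v / 2) * ennreal (1 / 2)"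
      by (subst (1 2) ennreal_mult[symmetric]) simp_all
    also have "ennreal (1 / 2) = emeasure lborel {1 / 2<..<1::real}"
      using emeasure_lborel_Ioo[of "1 / 2" 1] by simp
    also have "ennreal (levy_weight v / 2) * emeasure lborel {1 / 2<..<1::real}
        = (\<integral>\<^sup>+s. ennreal (levy_weight v / 2) * indicator {1 / 2<..<1::real} s \<partial>lborel)"
      by (rule nn_integral_cmult_indicator[symmetric]) simp
    also have "\<dots> \<le> (\<integral>\<^sup>+s. indicator {0<..<1} s * ennreal (1 / s) * ennreal (levy_weight (s *\<^sub>R v)) \<partial>lborel)"
    proof (rule nn_integral_mono)
      fix s :: real
      show "ennreal (levy_weight v / 2) * indicator {1 / 2<..<1} s
          \<le> indicator {0<..<1} s * ennreal (1 / s) * ennreal (levy_weight (s *\<^sub>R v))"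
      proof (cases "s \<in> {1 / 2<..<1}")
        case True
        then have s: "1 / 2 < s" "s < 1" by auto
        have "levy_weight v / 2 \<le> s * levy_weight v"
          using s mult_right_mono[of "1 / 2" s "levy_weight v"] by simp
        also have "\<dots> = 1 / s * (s\<^sup>2 * levy_weight v)"
          using s by (simp add: power2_eq_square)
        also have "\<dots> \<le> 1 / s * levy_weight (s *\<^sub>R v)"
          using s by (intro mult_left_mono levy_weight_scaleR) auto
        finally have "ennreal (levy_weight v / 2) \<le> ennreal (1 / s) * ennreal (levy_weight (s *\<^sub>R v))"
          using s by (simp add: ennreal_leI flip: ennreal_mult)
        then show ?thesis using s by simp
      qed simp
    qed
    finally show "ennreal (1 / 4) * ennreal (levy_weight v)
        \<le> (\<integral>\<^sup>+s. indicator {0<..<1} s * ennreal (1 / s) * ennreal (levy_weight (s *\<^sub>R v)) \<partial>lborel)" .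
  qed
  also have "\<dots> < \<infinity>" by (rule \<nu>_weight)
  finally have "ennreal (1 / 4) * (\<integral>\<^sup>+u. ennreal (levy_weight u) \<partial>\<nu>t) < \<infinity>"
    by (simp add: nn_integral_cmult)
  then show ?thesis
    by (auto simp: ennreal_mult_less_top)
qed

sublocale \<nu>: sigma_finite_measure \<nu>
  by (rule sigma_finite_levy_weight[OF sets_\<nu> \<nu>_0 \<nu>_weight])

sublocale \<nu>t: sigma_finite_measure \<nu>t
  by (rule sigma_finite_levy_weight[OF sets_\<nu>t \<nu>t_0 \<nu>t_weight])

lemmas int_weight_\<nu> = integrable_levy_weight[OF sets_\<nu> \<nu>_0 \<nu>_weight]
lemmas int_weight_\<nu>t = integrable_levy_weight[OF sets_\<nu>t \<nu>t_0 \<nu>t_weight]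

lemma integrable_\<nu>:
  fixes H :: "'a \<Rightarrow> complex"
  assumes [measurable]: "H \<in> borel_measurable borel" and "\<And>u. cmod (H u) \<le> C * levy_weight u"
  shows "integrable \<nu> H"
  by (rule Bochner_Integration.integrable_bound[OF integrable_mult_right[OF int_weight_\<nu>, of C]])
     (auto intro!: AE_I2 order_trans[OF assms(2)] simp: abs_mult mult_right_mono)

lemma integrable_\<nu>t:
  fixes H :: "'a \<Rightarrow> complex"
  assumes [measurable]: "H \<in> borel_measurable borel" and "\<And>u. cmod (H u) \<le> C * levy_weight u"
  shows "integrable \<nu>t H"
  by (rule Bochner_Integration.integrable_bound[OF integrable_mult_right[OF int_weight_\<nu>t, of C]])
     (auto intro!: AE_I2 order_trans[OF assms(2)] simp: abs_mult mult_right_mono)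

text \<open>For complex integrands the identity is lifted to measures: \<open>\<nu>\<close> is the
  image of \<open>L \<Otimes>\<^sub>M \<nu>t\<close>, where \<open>L\<close> is ds/s on (0, 1).
  \<open>L\<close> is infinite but sigma-finite, and integrability is transported along with the
  integral.\<close>

lemma integral_scaling:
  fixes H :: "'a \<Rightarrow> complex"
  assumes H: "integrable \<nu> H"
  shows "integral\<^sup>L \<nu> H = (\<integral>v. \<integral>s. (indicator {0<..<1} s / s) *\<^sub>R H (s *\<^sub>R v) \<partial>lborel \<partial>\<nu>t)"
proof -
  have Hm [measurable]: "H \<in> borel_measurable borel" using H by auto
  let ?g = "\<lambda>s::real. indicator {0<..<1} s / s :: real"
  define L where "L = density lborel (\<lambda>s. ennreal (?g s))"
  have sets_L [measurable_cong]: "sets L = sets borel" by (simp add: L_def)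
  have g: "ennreal (?g s) = indicator {0<..<1} s * ennreal (1 / s)" for s
    by (auto simp: indicator_def)
  have L: "sigma_finite_measure L"
    unfolding L_def by (subst sigma_finite_measure.sigma_finite_iff_density_finite'[OF sigma_finite_lborel]) auto
  interpret P: pair_sigma_finite L \<nu>t
    using L \<nu>t.sigma_finite_measure_axioms by (rule pair_sigma_finite.intro)
  have m: "(\<lambda>(s, v). s *\<^sub>R v) \<in> L \<Otimes>\<^sub>M \<nu>t \<rightarrow>\<^sub>M (borel :: 'a measure)" by measurable
  have "\<nu> = distr (L \<Otimes>\<^sub>M \<nu>t) borel (\<lambda>(s, v). s *\<^sub>R v)"
  proof (rule measure_eqI)
    fix A assume "A \<in> sets \<nu>"
    then have [measurable]: "A \<in> sets borel" by (simp add: sets_\<nu>)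
    have "emeasure \<nu> A = (\<integral>\<^sup>+u. indicator A u \<partial>\<nu>)" by (simp add: sets_\<nu>)
    also have "\<dots> = (\<integral>\<^sup>+v. \<integral>\<^sup>+s. indicator {0<..<1} s * ennreal (1 / s) * indicator A (s *\<^sub>R v) \<partial>lborel \<partial>\<nu>t)"
      by (rule nn_integral_scaling) measurable
    also have "\<dots> = (\<integral>\<^sup>+v. \<integral>\<^sup>+s. indicator A (s *\<^sub>R v) \<partial>L \<partial>\<nu>t)"
      unfolding L_def g[symmetric] by (subst nn_integral_density) auto
    also have "\<dots> = (\<integral>\<^sup>+p. indicator A (case p of (s, v) \<Rightarrow> s *\<^sub>R v) \<partial>(L \<Otimes>\<^sub>M \<nu>t))"
      by (subst P.nn_integral_snd[symmetric]) auto
    also have "\<dots> = (\<integral>\<^sup>+u. indicator A u \<partial>distr (L \<Otimes>\<^sub>M \<nu>t) borel (\<lambda>(s, v). s *\<^sub>R v))"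
      by (rule nn_integral_distr[symmetric, OF m]) simp
    also have "\<dots> = emeasure (distr (L \<Otimes>\<^sub>M \<nu>t) borel (\<lambda>(s, v). s *\<^sub>R v)) A" by simp
    finally show "emeasure \<nu> A = emeasure (distr (L \<Otimes>\<^sub>M \<nu>t) borel (\<lambda>(s, v). s *\<^sub>R v)) A" .
  qed (simp add: sets_\<nu>)
  note eq = this
  have int: "integrable (L \<Otimes>\<^sub>M \<nu>t) (\<lambda>(s, v). H (s *\<^sub>R v))"
    using integrable_distr[OF m, of H] H unfolding eq[symmetric] by (simp add: split_beta')
  have "integral\<^sup>L \<nu> H = (\<integral>p. H (case p of (s, v) \<Rightarrow> s *\<^sub>R v) \<partial>(L \<Otimes>\<^sub>M \<nu>t))"
    by (subst eq, rule integral_distr[OF m Hm])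
  also have "\<dots> = (\<integral>(s, v). H (s *\<^sub>R v) \<partial>(L \<Otimes>\<^sub>M \<nu>t))"
    by (simp add: split_beta')
  also have "\<dots> = (\<integral>v. \<integral>s. H (s *\<^sub>R v) \<partial>L \<partial>\<nu>t)"
    using P.integral_snd[OF int] by simp
  also have "\<dots> = (\<integral>v. \<integral>s. ?g s *\<^sub>R H (s *\<^sub>R v) \<partial>lborel \<partial>\<nu>t)"
    unfolding L_def by (subst integral_density) (auto intro!: AE_I2 simp: indicator_def)
  finally show ?thesis .
qed

text \<open>The form in which the symbol arises from \<open>levy_op\<close>: the gradient
  contributes the factor i u.\<xi>, the difference of gradients the increment of the
  exponential.\<close>

definition "\<psi> \<xi> = (\<integral>u. \<i> * complex_of_real (u \<bullet> \<xi>) * (iexp (u \<bullet> \<xi>) - 1) \<partial>\<nu>)"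

lemma integral_FTC_iexp:
  "(\<integral>s. indicator {0<..<1} s *\<^sub>R (\<i> * complex_of_real a * (iexp (s * a) - 1)) \<partial>lborel) = iexp a - 1 - \<i> * a"
proof -
  let ?f = "\<lambda>s. \<i> * complex_of_real a * (iexp (s * a) - 1)"
  \<comment> \<open>The fundamental theorem needs the closed interval; its endpoints are
    null.\<close>
  have "(\<integral>s. indicator {0<..<1} s *\<^sub>R ?f s \<partial>lborel) = (\<integral>s. indicator {0..1} s *\<^sub>R ?f s \<partial>lborel)"
  proof (rule integral_cong_AE)
    show "AE s in lborel. indicator {0<..<1} s *\<^sub>R ?f s = indicator {0..1} s *\<^sub>R ?f s"
      using AE_lborel_singleton[of 0] AE_lborel_singleton[of 1]
      by eventually_elim (auto simp: indicator_def)
  qed measurable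
  also have "\<dots> = (iexp (1 * a) - \<i> * (1 * a)) - (iexp (0 * a) - \<i> * (0 * a))"
  proof (rule integral_FTC_atLeastAtMost)
    fix s :: real
    have "((\<lambda>z. exp (\<i> * (z * complex_of_real a)) - \<i> * (z * complex_of_real a)) has_field_derivative
        \<i> * complex_of_real a * (exp (\<i> * (complex_of_real s * complex_of_real a)) - 1)) (at (complex_of_real s))"
      by (auto intro!: derivative_eq_intros simp: algebra_simps)
    from has_vector_derivative_real_field[OF this]
    show "((\<lambda>s. iexp (s * a) - \<i> * (s * a)) has_vector_derivative ?f s) (at s within {0..1})"
      by (simp add: has_vector_derivative_at_within)
  qed (auto intro!: continuous_intros)
  finally show ?thesis by simp
qed

text \<open>The factor s from the inner product with s v cancels the density 1/s. What remains is
  the derivative in s of the exponential minus its linear part, which integrates over (0, 1) to the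
  compensated exponential.\<close>

lemma \<psi>_eq: "\<psi> \<xi> = (\<integral>v. iexp (v \<bullet> \<xi>) - 1 - \<i> * complex_of_real (v \<bullet> \<xi>) \<partial>\<nu>t)"
proof -
  have "integrable \<nu> (\<lambda>u. \<i> * complex_of_real (u \<bullet> \<xi>) * (iexp (u \<bullet> \<xi>) - 1))"
    by (rule integrable_\<nu>) (use inner_iexp_bound in \<open>auto simp: norm_mult\<close>)
  then have "\<psi> \<xi> = (\<integral>v. \<integral>s. (indicator {0<..<1} s / s) *\<^sub>R
      (\<i> * complex_of_real ((s *\<^sub>R v) \<bullet> \<xi>) * (iexp ((s *\<^sub>R v) \<bullet> \<xi>) - 1)) \<partial>lborel \<partial>\<nu>t)"
    unfolding \<psi>_def by (rule integral_scaling)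
  also have "\<dots> = (\<integral>v. \<integral>s. indicator {0<..<1} s *\<^sub>R
      (\<i> * complex_of_real (v \<bullet> \<xi>) * (iexp (s * (v \<bullet> \<xi>)) - 1)) \<partial>lborel \<partial>\<nu>t)"
    by (intro Bochner_Integration.integral_cong refl) (auto simp: indicator_def scaleR_conv_of_real)
  finally show ?thesis unfolding integral_FTC_iexp .
qed

lemma integrable_sigma:
  "integrable \<nu>t (\<lambda>u. (iexp (u \<bullet> \<xi>) - 1) * (iexp (u \<bullet> \<zeta>) - 1))"
  by (rule integrable_\<nu>t[OF _ iexp_iexp_bound]) measurable

text \<open>The linear compensators cancel by additivity, and e^(p+q) - e^p - e^q + 1 factors as
  (e^p - 1)(e^q - 1).\<close>

lemma \<psi>_add: "\<psi> (\<xi> + \<zeta>) - \<psi> \<xi> - \<psi> \<zeta> = sigma_symbol \<nu>t \<xi> \<zeta>"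
proof -
  have i: "integrable \<nu>t (\<lambda>u. iexp (u \<bullet> \<eta>) - 1 - \<i> * complex_of_real (u \<bullet> \<eta>))" for \<eta>
    by (rule integrable_\<nu>t[OF _ iexp_second_order_bound]) measurable
  have "\<psi> (\<xi> + \<zeta>) - \<psi> \<xi> - \<psi> \<zeta> = (\<integral>u. (iexp (u \<bullet> (\<xi> + \<zeta>)) - 1 - \<i> * complex_of_real (u \<bullet> (\<xi> + \<zeta>)))
      - (iexp (u \<bullet> \<xi>) - 1 - \<i> * complex_of_real (u \<bullet> \<xi>))
      - (iexp (u \<bullet> \<zeta>) - 1 - \<i> * complex_of_real (u \<bullet> \<zeta>)) \<partial>\<nu>t)"
    unfolding \<psi>_eq by (simp only: Bochner_Integration.integral_diff Bochner_Integration.integrable_diff i)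
  also have "\<dots> = sigma_symbol \<nu>t \<xi> \<zeta>"
    unfolding sigma_symbol_def
    by (intro Bochner_Integration.integral_cong refl)
       (simp add: inner_add_right distrib_left exp_add algebra_simps)
  finally show ?thesis .
qed

lemma sigma_symbol_commute: "sigma_symbol \<nu>t \<xi> \<zeta> = sigma_symbol \<nu>t \<zeta> \<xi>"
  unfolding sigma_symbol_def by (simp add: mult.commute)

text \<open>The non-symmetric half of \<open>rho_symbol\<close> that arises when
  \<open>levy_op\<close> falls on the function with frequency \<xi>.\<close>

definition "R \<xi> \<zeta> = (\<integral>u. \<i> * complex_of_real (u \<bullet> \<xi>) * iexp (u \<bullet> \<xi>) * (iexp (u \<bullet> \<zeta>) - 1) \<partial>\<nu>t)"

lemma R_bound: "cmod (\<i> * complex_of_real (u \<bullet> \<xi>) * iexp (u \<bullet> \<xi>) * (iexp (u \<bullet> \<zeta>) - 1))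
    \<le> 2 * ((1 + norm \<xi>) * (1 + norm \<zeta>)) * levy_weight u"
  using inner_iexp_bound[of u \<xi> \<zeta>] by (simp add: norm_mult mult_ac)

lemma integrable_R:
  "integrable \<nu>t (\<lambda>u. \<i> * complex_of_real (u \<bullet> \<xi>) * iexp (u \<bullet> \<xi>) * (iexp (u \<bullet> \<zeta>) - 1))"
  by (rule integrable_\<nu>t[OF _ R_bound]) measurable

lemma rho_symbol_eq: "rho_symbol \<nu>t \<xi> \<zeta> = R \<xi> \<zeta> + R \<zeta> \<xi>"
  unfolding rho_symbol_def R_def by simp

text \<open>One constant for the symbols over both measures; the 2 is the factor in the pointwise
  bounds by \<open>levy_weight\<close>.\<close>

definition "K = 2 * ((\<integral>u. levy_weight u \<partial>\<nu>) + (\<integral>u. levy_weight u \<partial>\<nu>t))"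

lemma K_nonneg: "0 \<le> K"
  unfolding K_def by simp

lemma K_bound:
  assumes "\<And>u. cmod (H u) \<le> 2 * C * levy_weight u" and "0 \<le> C"
  shows "cmod (integral\<^sup>L \<nu> H) \<le> K * C" "cmod (integral\<^sup>L \<nu>t H) \<le> K * C"
proof -
  have 1: "cmod (integral\<^sup>L \<nu> H) \<le> (\<integral>u. 2 * C * levy_weight u \<partial>\<nu>)"
    by (rule norm_integral_le[OF integrable_mult_right[OF int_weight_\<nu>] assms(1)])
  have 2: "cmod (integral\<^sup>L \<nu>t H) \<le> (\<integral>u. 2 * C * levy_weight u \<partial>\<nu>t)"
    by (rule norm_integral_le[OF integrable_mult_right[OF int_weight_\<nu>t] assms(1)])
  have 3: "0 \<le> C * (\<integral>u. levy_weight u \<partial>\<nu>)" "0 \<le> C * (\<integral>u. levy_weight u \<partial>\<nu>t)"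
    using assms(2) by auto
  show "cmod (integral\<^sup>L \<nu> H) \<le> K * C" "cmod (integral\<^sup>L \<nu>t H) \<le> K * C"
    using 1 2 3 by (simp_all add: K_def algebra_simps)
qed

lemma
  shows \<psi>_bound: "cmod (\<psi> \<xi>) \<le> K * ((1 + norm \<xi>) * (1 + norm \<xi>))"
    and sigma_bound: "cmod (sigma_symbol \<nu>t \<xi> \<zeta>) \<le> K * ((1 + norm \<xi>) * (1 + norm \<zeta>))"
    and R_symbol_bound: "cmod (R \<xi> \<zeta>) \<le> K * ((1 + norm \<xi>) * (1 + norm \<zeta>))"
  unfolding \<psi>_def sigma_symbol_def R_def
  using inner_iexp_bound[of _ \<xi> \<xi>]
  by (intro K_bound iexp_iexp_bound R_bound; simp add: norm_mult)+

lemma borel_measurable_\<psi> [measurable]: "\<psi> \<in> borel_measurable borel"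
  unfolding \<psi>_def by measurable

lemma borel_measurable_sigma [measurable]:
  "(\<lambda>(\<xi>, \<zeta>). sigma_symbol \<nu>t \<xi> \<zeta>) \<in> borel_measurable (borel \<Otimes>\<^sub>M borel)"
  unfolding sigma_symbol_def by measurable

lemma borel_measurable_R [measurable]: "(\<lambda>(\<xi>, \<zeta>). R \<xi> \<zeta>) \<in> borel_measurable (borel \<Otimes>\<^sub>M borel)"
  unfolding R_def by measurable

end

section \<open>The operators on plane waves\<close>

text \<open>Moments of every order are required because each symbol costs further powers of 1 +
  |\<xi>|. The density includes the normalising power of 2 pi.\<close>

definition wave_density :: "('a::euclidean_space \<Rightarrow> complex) \<Rightarrow> ('a \<Rightarrow> real) \<Rightarrow> bool" where
  "wave_density c f \<longleftrightarrow> c \<in> borel_measurable borel \<and>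
     (\<forall>n. integrable lborel (\<lambda>\<xi>. (1 + norm \<xi>) ^ n * cmod (c \<xi>))) \<and>
     (\<forall>x. complex_of_real (f x) = (\<integral>\<xi>. c \<xi> * iexp (x \<bullet> \<xi>) \<partial>lborel))"

lemma wave_density_schwartz:
  fixes f :: "'a::euclidean_space \<Rightarrow> real"
  assumes f: "schwartz f"
  shows "wave_density (\<lambda>\<xi>. fourier f \<xi> / (2 * pi) ^ DIM('a)) f"
proof -
  have F [measurable]: "fourier f \<in> borel_measurable borel"
    by (intro fourier_borel_measurable schwartz_borel_measurable f)
  have "integrable lborel (\<lambda>\<xi>. (1 + norm \<xi>) ^ n * cmod (fourier f \<xi>))" for n
    by (intro integrable_decay F fourier_decay f)
  then have "integrable lborel (\<lambda>\<xi>. (1 + norm \<xi>) ^ n * cmod (fourier f \<xi>) / (2 * pi) ^ DIM('a))" for n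
    by (rule integrable_divide)
  then have "integrable lborel (\<lambda>\<xi>. (1 + norm \<xi>) ^ n * cmod (fourier f \<xi> / (2 * pi) ^ DIM('a)))" for n
    by (simp add: norm_divide norm_power norm_mult)
  moreover have "complex_of_real (f x) = (\<integral>\<xi>. fourier f \<xi> / (2 * pi) ^ DIM('a) * iexp (x \<bullet> \<xi>) \<partial>lborel)" for x
  proof -
    have "(\<integral>\<xi>. fourier f \<xi> / (2 * pi) ^ DIM('a) * iexp (x \<bullet> \<xi>) \<partial>lborel)
        = (\<integral>\<xi>. fourier f \<xi> * iexp (x \<bullet> \<xi>) \<partial>lborel) / (2 * pi) ^ DIM('a)"
      by (subst integral_divide_zero[symmetric]) simp
    then show ?thesis unfolding fourier_inversion[OF f] by simp
  qed
  ultimately show ?thesis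
    unfolding wave_density_def by auto
qed

lemma wave_density_wave:
  assumes "wave_density c f"
  shows "wave lborel c (\<lambda>\<xi>. \<xi>) f"
  using assms unfolding wave_density_def by unfold_locales auto

lemma integrable_wave_density_pair:
  assumes a: "wave_density a f" and b: "wave_density b g"
    and Q: "(\<lambda>(\<xi>, \<zeta>). Q \<xi> \<zeta>) \<in> borel_measurable (borel \<Otimes>\<^sub>M borel)"
    and bound: "\<And>\<xi> \<zeta>. cmod (Q \<xi> \<zeta>) \<le> C * ((1 + norm \<xi>) ^ n * (1 + norm \<zeta>) ^ n)"
  shows "integrable (lborel \<Otimes>\<^sub>M lborel) (\<lambda>(\<xi>, \<zeta>). a \<xi> * b \<zeta> * Q \<xi> \<zeta>)"
proof -
  note [measurable] = Q
  have [measurable]: "a \<in> borel_measurable borel" "b \<in> borel_measurable borel"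
    using a b by (auto simp: wave_density_def)
  show ?thesis
  proof (rule integrable_pair_bound)
    show "integrable lborel (\<lambda>\<xi>. C * ((1 + norm \<xi>) ^ n * cmod (a \<xi>)))"
      using a by (auto simp: wave_density_def)
    show "integrable lborel (\<lambda>\<zeta>. (1 + norm \<zeta>) ^ n * cmod (b \<zeta>))"
      using b by (auto simp: wave_density_def)
    show "norm (a \<xi> * b \<zeta> * Q \<xi> \<zeta>)
        \<le> C * ((1 + norm \<xi>) ^ n * cmod (a \<xi>)) * ((1 + norm \<zeta>) ^ n * cmod (b \<zeta>))" for \<xi> \<zeta>
      using mult_left_mono[OF bound[of \<xi> \<zeta>], of "cmod (a \<xi>) * cmod (b \<zeta>)"]
      by (simp add: norm_mult mult_ac)
  qed (measurable, auto simp: sigma_finite_lborel)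
qed

text \<open>Submultiplicativity lets growth in the sum frequency be shared out between the two
  densities.\<close>

lemma one_plus_norm_add_le:
  fixes \<xi> \<zeta> :: "'a::real_normed_vector"
  shows "1 + norm (\<xi> + \<zeta>) \<le> (1 + norm \<xi>) * (1 + norm \<zeta>)"
proof -
  have "0 \<le> norm \<xi> * norm \<zeta>" by simp
  with norm_triangle_ineq[of \<xi> \<zeta>] show ?thesis
    unfolding distrib_left distrib_right by linarith
qed

section \<open>The three terms of the iterated carre du champs\<close>

context levy_pair
begin

text \<open>Fubini between index and jump, dominated by the second moment times
  \<open>levy_weight\<close>, moves the jump integral onto each plane wave. The drift adds - i
  x.\<phi>, so plane waves are multiplied by a factor depending on x.\<close>

lemma levy_op_wave:
  assumes "wave m c \<phi> h"
  shows "complex_of_real (levy_op \<nu> h x)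
    = (\<integral>\<omega>. c \<omega> * (iexp (x \<bullet> \<phi> \<omega>) * (\<psi> (\<phi> \<omega>) - \<i> * complex_of_real (x \<bullet> \<phi> \<omega>))) \<partial>m)"
proof -
  interpret wave m c \<phi> h by fact
  let ?T = "\<lambda>\<omega> u. c \<omega> * (iexp (x \<bullet> \<phi> \<omega>) * (\<i> * complex_of_real (u \<bullet> \<phi> \<omega>) * (iexp (u \<bullet> \<phi> \<omega>) - 1)))"
  have Ti: "integrable (m \<Otimes>\<^sub>M \<nu>) (\<lambda>(\<omega>, u). ?T \<omega> u)"
  proof (rule integrable_pair_bound[OF m \<nu>.sigma_finite_measure_axioms _ _ int_weight_\<nu>])
    show "integrable m (\<lambda>\<omega>. 2 * ((1 + norm (\<phi> \<omega>))\<^sup>2 * cmod (c \<omega>)))"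
      by (intro integrable_mult_right moment)
    show "norm (?T \<omega> u) \<le> 2 * ((1 + norm (\<phi> \<omega>))\<^sup>2 * cmod (c \<omega>)) * levy_weight u" for \<omega> u
      using mult_left_mono[OF inner_iexp_bound[of u "\<phi> \<omega>" "\<phi> \<omega>"], of "cmod (c \<omega>)"]
      by (simp add: norm_mult power2_eq_square mult_ac)
  qed measurable
  interpret P: pair_sigma_finite m \<nu>
    using m \<nu>.sigma_finite_measure_axioms by (rule pair_sigma_finite.intro)
  have "complex_of_real ((grad h (x + u) - grad h x) \<bullet> u) = (\<integral>\<omega>. ?T \<omega> u \<partial>m)" for u
  proof -
    have "complex_of_real ((grad h (x + u) - grad h x) \<bullet> u) = D (x + u) u - D x u"
      by (simp only: of_real_inner_grad[symmetric] inner_commute[of _ u] inner_diff_right of_real_diff)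
    also have "\<dots> = (\<integral>\<omega>. c \<omega> * (\<i> * (u \<bullet> \<phi> \<omega>) * iexp ((x + u) \<bullet> \<phi> \<omega>))
        - c \<omega> * (\<i> * (u \<bullet> \<phi> \<omega>) * iexp (x \<bullet> \<phi> \<omega>)) \<partial>m)"
      unfolding D_def by (rule Bochner_Integration.integral_diff[OF integrable_wave1 integrable_wave1, symmetric])
    also have "\<dots> = (\<integral>\<omega>. ?T \<omega> u \<partial>m)"
      by (intro Bochner_Integration.integral_cong refl)
         (simp add: inner_add_left distrib_left exp_add algebra_simps)
    finally show ?thesis .
  qed
  then have "complex_of_real (\<integral>u. (grad h (x + u) - grad h x) \<bullet> u \<partial>\<nu>) = (\<integral>u. \<integral>\<omega>. ?T \<omega> u \<partial>m \<partial>\<nu>)"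
    by (simp only: integral_complex_of_real[symmetric])
  also have "\<dots> = (\<integral>\<omega>. \<integral>u. ?T \<omega> u \<partial>\<nu> \<partial>m)"
    by (rule P.Fubini_integral[OF Ti])
  also have "\<dots> = (\<integral>\<omega>. c \<omega> * (iexp (x \<bullet> \<phi> \<omega>) * \<psi> (\<phi> \<omega>)) \<partial>m)"
    unfolding \<psi>_def by (simp only: integral_mult_right_zero)
  finally have eq: "complex_of_real (\<integral>u. (grad h (x + u) - grad h x) \<bullet> u \<partial>\<nu>) = \<dots>" .
  have i: "integrable m (\<lambda>\<omega>. c \<omega> * (iexp (x \<bullet> \<phi> \<omega>) * \<psi> (\<phi> \<omega>)))"
  proof (rule integrable_bounded[where C = K])
    show "cmod (iexp (x \<bullet> \<phi> \<omega>) * \<psi> (\<phi> \<omega>)) \<le> K * (1 + norm (\<phi> \<omega>))\<^sup>2" for \<omega>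
      using \<psi>_bound[of "\<phi> \<omega>"] by (simp add: norm_mult power2_eq_square)
  qed measurable
  have "complex_of_real (levy_op \<nu> h x) = (\<integral>\<omega>. c \<omega> * (iexp (x \<bullet> \<phi> \<omega>) * \<psi> (\<phi> \<omega>)) \<partial>m) - D x x"
    unfolding levy_op_def of_real_add of_real_minus eq of_real_inner_grad by simp
  also have "\<dots> = (\<integral>\<omega>. c \<omega> * (iexp (x \<bullet> \<phi> \<omega>) * \<psi> (\<phi> \<omega>))
      - c \<omega> * (\<i> * (x \<bullet> \<phi> \<omega>) * iexp (x \<bullet> \<phi> \<omega>)) \<partial>m)"
    unfolding D_def by (rule Bochner_Integration.integral_diff[OF i integrable_wave1, symmetric])
  finally show ?thesis
    by (simp add: algebra_simps)
qed

text \<open>The two arguments are treated asymmetrically: the increment of \<open>F\<close> may have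
  any kernel \<open>p\<close>, because for \<open>F = levy_op \<nu> f\<close> it is not a mere
  difference of exponentials.\<close>

lemma Gamma1_superposition:
  fixes F G :: "'a \<Rightarrow> real" and \<alpha> \<beta> :: "'a \<Rightarrow> complex" and p :: "'a \<Rightarrow> 'a \<Rightarrow> complex"
  assumes [measurable]: "\<alpha> \<in> borel_measurable borel" "\<beta> \<in> borel_measurable borel"
      "(\<lambda>(\<xi>, u). p \<xi> u) \<in> borel_measurable (borel \<Otimes>\<^sub>M borel)"
    and F: "\<And>u. complex_of_real (F (x + u) - F x) = (\<integral>\<xi>. \<alpha> \<xi> * p \<xi> u \<partial>lborel)"
    and G: "\<And>u. complex_of_real (G (x + u) - G x) = (\<integral>\<zeta>. \<beta> \<zeta> * (iexp (u \<bullet> \<zeta>) - 1) \<partial>lborel)"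
    and bound: "\<And>\<xi> \<zeta> u. cmod (p \<xi> u * (iexp (u \<bullet> \<zeta>) - 1)) \<le> a \<xi> * (1 + norm \<zeta>) * levy_weight u"
    and \<alpha>: "integrable lborel (\<lambda>\<xi>. a \<xi> * cmod (\<alpha> \<xi>))"
    and \<beta>: "integrable lborel (\<lambda>\<zeta>. (1 + norm \<zeta>) * cmod (\<beta> \<zeta>))"
  shows "complex_of_real (Gamma1 \<nu>t F G x) = 1 / 2 *
    (\<integral>(\<xi>, \<zeta>). \<alpha> \<xi> * \<beta> \<zeta> * (\<integral>u. p \<xi> u * (iexp (u \<bullet> \<zeta>) - 1) \<partial>\<nu>t) \<partial>(lborel \<Otimes>\<^sub>M lborel))"
proof -
  let ?P = "lborel \<Otimes>\<^sub>M lborel :: ('a \<times> 'a) measure"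
  let ?T = "\<lambda>\<xi> \<zeta> u. \<alpha> \<xi> * \<beta> \<zeta> * (p \<xi> u * (iexp (u \<bullet> \<zeta>) - 1))"
  have P: "sigma_finite_measure ?P" by (rule sigma_finite_pair_measure) (rule sigma_finite_lborel)+
  have ab: "integrable ?P (\<lambda>(\<xi>, \<zeta>). (a \<xi> * cmod (\<alpha> \<xi>)) * ((1 + norm \<zeta>) * cmod (\<beta> \<zeta>)))"
    by (rule integrable_pair_mult[OF sigma_finite_lborel sigma_finite_lborel \<alpha> \<beta>])
  have Tn: "norm (?T \<xi> \<zeta> u) \<le> (a \<xi> * cmod (\<alpha> \<xi>)) * ((1 + norm \<zeta>) * cmod (\<beta> \<zeta>)) * levy_weight u" for \<xi> \<zeta> u
    using mult_left_mono[OF bound[of \<xi> u \<zeta>], of "cmod (\<alpha> \<xi>) * cmod (\<beta> \<zeta>)"]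
    by (simp add: norm_mult mult_ac)
  have Ti: "integrable (?P \<Otimes>\<^sub>M \<nu>t) (\<lambda>(q, u). case q of (\<xi>, \<zeta>) \<Rightarrow> ?T \<xi> \<zeta> u)"
  proof (rule integrable_pair_bound[OF P \<nu>t.sigma_finite_measure_axioms _ ab int_weight_\<nu>t])
    show "norm (case q of (\<xi>, \<zeta>) \<Rightarrow> ?T \<xi> \<zeta> u)
        \<le> (case q of (\<xi>, \<zeta>) \<Rightarrow> (a \<xi> * cmod (\<alpha> \<xi>)) * ((1 + norm \<zeta>) * cmod (\<beta> \<zeta>))) * levy_weight u" for q u
      using Tn by (cases q) simp
  qed measurable
  interpret PN: pair_sigma_finite ?P \<nu>t
    using P \<nu>t.sigma_finite_measure_axioms by (rule pair_sigma_finite.intro)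
  \<comment> \<open>The product of two frequency integrals becomes one integral over pairs, ready
    for the exchange with the jump integral.\<close>
  have prod: "complex_of_real ((F (x + u) - F x) * (G (x + u) - G x)) = (\<integral>(\<xi>, \<zeta>). ?T \<xi> \<zeta> u \<partial>?P)" for u
  proof -
    have "integrable ?P (\<lambda>(\<xi>, \<zeta>). ?T \<xi> \<zeta> u)"
    proof (rule integrable_pair_bound[OF sigma_finite_lborel sigma_finite_lborel _ \<alpha> integrable_mult_left[OF \<beta>, of "levy_weight u"]])
      show "norm (?T \<xi> \<zeta> u) \<le> (a \<xi> * cmod (\<alpha> \<xi>)) * ((1 + norm \<zeta>) * cmod (\<beta> \<zeta>) * levy_weight u)" for \<xi> \<zeta>
        using Tn[of \<xi> \<zeta> u] by (simp add: mult_ac)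
    qed measurable
    from lborel_pair.integral_snd[OF this]
    have "(\<integral>(\<xi>, \<zeta>). ?T \<xi> \<zeta> u \<partial>?P) = (\<integral>\<zeta>. \<integral>\<xi>. ?T \<xi> \<zeta> u \<partial>lborel \<partial>lborel)"
      by simp
    also have "\<dots> = (\<integral>\<zeta>. \<integral>\<xi>. (\<alpha> \<xi> * p \<xi> u) * (\<beta> \<zeta> * (iexp (u \<bullet> \<zeta>) - 1)) \<partial>lborel \<partial>lborel)"
      by (simp only: mult_ac)
    also have "\<dots> = complex_of_real (F (x + u) - F x) * complex_of_real (G (x + u) - G x)"
      unfolding F G by (simp only: integral_mult_left_zero integral_mult_right_zero)
    finally show ?thesis by simp
  qed
  have "complex_of_real (Gamma1 \<nu>t F G x)
      = 1 / 2 * (\<integral>u. complex_of_real ((F (x + u) - F x) * (G (x + u) - G x)) \<partial>\<nu>t)"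
    unfolding Gamma1_def of_real_mult[of "1 / 2"] integral_complex_of_real by simp
  also have "(\<integral>u. complex_of_real ((F (x + u) - F x) * (G (x + u) - G x)) \<partial>\<nu>t)
      = (\<integral>u. \<integral>q. (case q of (\<xi>, \<zeta>) \<Rightarrow> ?T \<xi> \<zeta> u) \<partial>?P \<partial>\<nu>t)"
    unfolding prod ..
  also have "\<dots> = (\<integral>q. \<integral>u. (case q of (\<xi>, \<zeta>) \<Rightarrow> ?T \<xi> \<zeta> u) \<partial>\<nu>t \<partial>?P)"
    by (rule PN.Fubini_integral[OF Ti])
  also have "\<dots> = (\<integral>(\<xi>, \<zeta>). \<alpha> \<xi> * \<beta> \<zeta> * (\<integral>u. p \<xi> u * (iexp (u \<bullet> \<zeta>) - 1) \<partial>\<nu>t) \<partial>?P)"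
    by (intro Bochner_Integration.integral_cong refl) (simp add: split_beta')
  finally show ?thesis .
qed

lemma wave_density_diff:
  assumes "wave_density a f"
  shows "complex_of_real (f (x + u) - f x) = (\<integral>\<xi>. (a \<xi> * iexp (x \<bullet> \<xi>)) * (iexp (u \<bullet> \<xi>) - 1) \<partial>lborel)"
proof -
  interpret wave lborel a "\<lambda>\<xi>. \<xi>" f using assms by (rule wave_density_wave)
  have "complex_of_real (f (x + u) - f x) = (\<integral>\<xi>. a \<xi> * iexp ((x + u) \<bullet> \<xi>) - a \<xi> * iexp (x \<bullet> \<xi>) \<partial>lborel)"
    unfolding of_real_diff h_eq
    by (rule Bochner_Integration.integral_diff[OF integrable_wave0 integrable_wave0, symmetric])
  then show ?thesis
    by (simp add: inner_add_left distrib_left exp_add algebra_simps)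
qed

lemma wave_density_moment:
  assumes "wave_density a f"
  shows "integrable lborel (\<lambda>\<xi>. (1 + norm \<xi>) ^ n * cmod (a \<xi> * iexp (x \<bullet> \<xi>)))"
  using assms by (simp add: wave_density_def norm_mult)

text \<open>The product of two plane waves is a plane wave with the sum frequency, so the carre du
  champs is again a superposition and \<open>levy_op_wave\<close> applies to it.\<close>

lemma Gamma1_wave:
  assumes f: "wave_density a f" and g: "wave_density b g"
  shows "wave (lborel \<Otimes>\<^sub>M lborel) (\<lambda>(\<xi>, \<zeta>). a \<xi> * b \<zeta> * (sigma_symbol \<nu>t \<xi> \<zeta> / 2)) (\<lambda>(\<xi>, \<zeta>). \<xi> + \<zeta>)
    (Gamma1 \<nu>t f g)"
proof (rule wave.intro)
  have [measurable]: "a \<in> borel_measurable borel" "b \<in> borel_measurable borel"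
    using f g by (auto simp: wave_density_def)
  show "sigma_finite_measure (lborel \<Otimes>\<^sub>M lborel :: ('a \<times> 'a) measure)"
    by (rule sigma_finite_pair_measure[OF sigma_finite_lborel sigma_finite_lborel])
  show "(\<lambda>(\<xi>, \<zeta>). a \<xi> * b \<zeta> * (sigma_symbol \<nu>t \<xi> \<zeta> / 2)) \<in> borel_measurable (lborel \<Otimes>\<^sub>M lborel)"
    by measurable
  show "(\<lambda>(\<xi>, \<zeta>). \<xi> + \<zeta>) \<in> borel_measurable (lborel \<Otimes>\<^sub>M lborel)"
    by measurable
  have "integrable (lborel \<Otimes>\<^sub>M lborel)
      (\<lambda>(\<xi>, \<zeta>). a \<xi> * b \<zeta> * (complex_of_real ((1 + norm (\<xi> + \<zeta>))\<^sup>2) * (sigma_symbol \<nu>t \<xi> \<zeta> / 2)))"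
  proof (rule integrable_wave_density_pair[OF f g])
    fix \<xi> \<zeta> :: 'a
    have "(1 + norm (\<xi> + \<zeta>))\<^sup>2 \<le> ((1 + norm \<xi>) * (1 + norm \<zeta>))\<^sup>2"
      by (intro power_mono one_plus_norm_add_le) simp
    then have "(1 + norm (\<xi> + \<zeta>))\<^sup>2 * cmod (sigma_symbol \<nu>t \<xi> \<zeta>)
        \<le> ((1 + norm \<xi>) * (1 + norm \<zeta>))\<^sup>2 * (K * ((1 + norm \<xi>) * (1 + norm \<zeta>)))"
      by (intro mult_mono sigma_bound) auto
    \<comment> \<open>Of the three powers, two come from the second moment at the sum frequency and
      one from the bound on \<open>sigma_symbol\<close>.\<close>
    then show "cmod (complex_of_real ((1 + norm (\<xi> + \<zeta>))\<^sup>2) * (sigma_symbol \<nu>t \<xi> \<zeta> / 2))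
        \<le> K / 2 * ((1 + norm \<xi>) ^ 3 * (1 + norm \<zeta>) ^ 3)"
      unfolding norm_mult norm_divide norm_of_real
      by (simp add: power2_eq_square power3_eq_cube mult_ac)
  qed measurable
  note int = this
  have eq: "norm (case \<omega> of (\<xi>, \<zeta>) \<Rightarrow>
        a \<xi> * b \<zeta> * (complex_of_real ((1 + norm (\<xi> + \<zeta>))\<^sup>2) * (sigma_symbol \<nu>t \<xi> \<zeta> / 2)))
      = (1 + norm (case \<omega> of (\<xi>, \<zeta>) \<Rightarrow> \<xi> + \<zeta>))\<^sup>2 *
        cmod (case \<omega> of (\<xi>, \<zeta>) \<Rightarrow> a \<xi> * b \<zeta> * (sigma_symbol \<nu>t \<xi> \<zeta> / 2))" for \<omega>
    by (cases \<omega>) (simp only: prod.case norm_mult norm_of_real abs_power2, simp only: mult_ac)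
  from integrable_norm[OF int]
  show "integrable (lborel \<Otimes>\<^sub>M lborel) (\<lambda>\<omega>. (1 + norm (case \<omega> of (\<xi>, \<zeta>) \<Rightarrow> \<xi> + \<zeta>))\<^sup>2 *
      cmod (case \<omega> of (\<xi>, \<zeta>) \<Rightarrow> a \<xi> * b \<zeta> * (sigma_symbol \<nu>t \<xi> \<zeta> / 2)))"
    unfolding eq .
  fix x
  have "complex_of_real (Gamma1 \<nu>t f g x) = 1 / 2 *
    (\<integral>(\<xi>, \<zeta>). (a \<xi> * iexp (x \<bullet> \<xi>)) * (b \<zeta> * iexp (x \<bullet> \<zeta>)) *
      (\<integral>u. (iexp (u \<bullet> \<xi>) - 1) * (iexp (u \<bullet> \<zeta>) - 1) \<partial>\<nu>t) \<partial>(lborel \<Otimes>\<^sub>M lborel))"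
  proof (rule Gamma1_superposition[where a = "\<lambda>\<xi>. 2 * (1 + norm \<xi>)"
        and \<alpha> = "\<lambda>\<xi>. a \<xi> * iexp (x \<bullet> \<xi>)" and \<beta> = "\<lambda>\<xi>. b \<xi> * iexp (x \<bullet> \<xi>)"
        and p = "\<lambda>\<xi> u. iexp (u \<bullet> \<xi>) - 1", OF _ _ _ wave_density_diff[OF f] wave_density_diff[OF g]])
    show "cmod ((iexp (u \<bullet> \<xi>) - 1) * (iexp (u \<bullet> \<zeta>) - 1)) \<le> 2 * (1 + norm \<xi>) * (1 + norm \<zeta>) * levy_weight u" for \<xi> \<zeta> u :: 'a
      using iexp_iexp_bound[of u \<xi> \<zeta>] by (simp only: mult.assoc)
    show "integrable lborel (\<lambda>\<xi>. 2 * (1 + norm \<xi>) * cmod (a \<xi> * iexp (x \<bullet> \<xi>)))"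
      using integrable_mult_right[OF wave_density_moment[OF f, of 1 x], of 2]
      by (simp only: mult.assoc power_one_right)
    show "integrable lborel (\<lambda>\<xi>. (1 + norm \<xi>) * cmod (b \<xi> * iexp (x \<bullet> \<xi>)))"
      using wave_density_moment[OF g, of 1 x] by simp
  qed measurable
  also have "\<dots> = (\<integral>\<omega>. 1 / 2 * (case \<omega> of (\<xi>, \<zeta>) \<Rightarrow> (a \<xi> * iexp (x \<bullet> \<xi>)) * (b \<zeta> * iexp (x \<bullet> \<zeta>)) *
      sigma_symbol \<nu>t \<xi> \<zeta>) \<partial>(lborel \<Otimes>\<^sub>M lborel))"
    unfolding sigma_symbol_def by (rule integral_mult_right_zero[symmetric])
  also have "\<dots> = (\<integral>\<omega>. (case \<omega> of (\<xi>, \<zeta>) \<Rightarrow> a \<xi> * b \<zeta> * (sigma_symbol \<nu>t \<xi> \<zeta> / 2)) *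
      iexp (x \<bullet> (case \<omega> of (\<xi>, \<zeta>) \<Rightarrow> \<xi> + \<zeta>)) \<partial>(lborel \<Otimes>\<^sub>M lborel))"
    by (intro Bochner_Integration.integral_cong refl)
       (auto simp: split_beta' inner_add_right distrib_left exp_add)
  finally show "complex_of_real (Gamma1 \<nu>t f g x) = \<dots>" .
qed

lemma drift_symbol_bound:
  "cmod (\<psi> \<eta> - \<i> * complex_of_real (x \<bullet> \<eta>)) \<le> (K + norm x) * (1 + norm \<eta>)\<^sup>2"
proof -
  have "cmod (\<psi> \<eta> - \<i> * complex_of_real (x \<bullet> \<eta>)) \<le> cmod (\<psi> \<eta>) + \<bar>x \<bullet> \<eta>\<bar>"
    using norm_triangle_ineq4[of "\<psi> \<eta>" "\<i> * complex_of_real (x \<bullet> \<eta>)"] by (simp add: norm_mult)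
  also have "\<dots> \<le> K * (1 + norm \<eta>)\<^sup>2 + norm x * (1 + norm \<eta>)\<^sup>2"
  proof (rule add_mono)
    have "\<bar>x \<bullet> \<eta>\<bar> \<le> norm x * norm \<eta>" by (rule Cauchy_Schwarz_ineq2)
    also have "\<dots> \<le> norm x * (1 + norm \<eta>)\<^sup>2"
      by (intro mult_left_mono) (auto simp: power2_eq_square algebra_simps)
    finally show "\<bar>x \<bullet> \<eta>\<bar> \<le> norm x * (1 + norm \<eta>)\<^sup>2" .
  qed (use \<psi>_bound[of \<eta>] in \<open>simp add: power2_eq_square\<close>)
  finally show ?thesis by (simp add: distrib_right)
qed

text \<open>The multiplier at x + u differs from that at x by - i u.\<xi>. This splits the increment
  into the multiplier at x times a difference of exponentials, giving \<open>sigma_symbol\<close>,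
  and a remainder, giving \<open>R\<close>.\<close>

lemma Gamma1_levy_op:
  assumes f: "wave_density a f" and g: "wave_density b g"
  shows "complex_of_real (Gamma1 \<nu>t (levy_op \<nu> f) g x) = 1 / 2 *
    (\<integral>(\<xi>, \<zeta>). (a \<xi> * iexp (x \<bullet> \<xi>)) * (b \<zeta> * iexp (x \<bullet> \<zeta>)) *
      ((\<psi> \<xi> - \<i> * complex_of_real (x \<bullet> \<xi>)) * sigma_symbol \<nu>t \<xi> \<zeta> - R \<xi> \<zeta>) \<partial>(lborel \<Otimes>\<^sub>M lborel))"
proof -
  have [measurable]: "a \<in> borel_measurable borel" "b \<in> borel_measurable borel"
    using f g by (auto simp: wave_density_def)
  interpret wave lborel a "\<lambda>\<xi>. \<xi>" f using f by (rule wave_density_wave)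
  let ?d = "\<lambda>\<xi>. \<psi> \<xi> - \<i> * complex_of_real (x \<bullet> \<xi>)"
  let ?r = "\<lambda>\<xi> u. \<i> * complex_of_real (u \<bullet> \<xi>) * iexp (u \<bullet> \<xi>)"
  let ?p = "\<lambda>\<xi> u. ?d \<xi> * (iexp (u \<bullet> \<xi>) - 1) - ?r \<xi> u"
  \<comment> \<open>The cube combines the quadratic growth of the multiplier with one power from the
    increments; the first power belongs to the remainder \<open>?r\<close>.\<close>
  let ?a = "\<lambda>\<xi>. 2 * ((K + norm x) * (1 + norm \<xi>) ^ 3 + (1 + norm \<xi>) ^ 1)"
  have i: "integrable lborel (\<lambda>\<xi>. a \<xi> * (iexp (y \<bullet> \<xi>) * (\<psi> \<xi> - \<i> * complex_of_real (y \<bullet> \<xi>))))" for y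
    by (rule integrable_bounded[where C = "K + norm y"])
       (measurable, use drift_symbol_bound in \<open>simp add: norm_mult\<close>)
  have diff: "complex_of_real (levy_op \<nu> f (x + u) - levy_op \<nu> f x)
      = (\<integral>\<xi>. (a \<xi> * iexp (x \<bullet> \<xi>)) * ?p \<xi> u \<partial>lborel)" for u
  proof -
    have "complex_of_real (levy_op \<nu> f (x + u) - levy_op \<nu> f x)
        = (\<integral>\<xi>. a \<xi> * (iexp ((x + u) \<bullet> \<xi>) * (\<psi> \<xi> - \<i> * complex_of_real ((x + u) \<bullet> \<xi>)))
          - a \<xi> * (iexp (x \<bullet> \<xi>) * (\<psi> \<xi> - \<i> * complex_of_real (x \<bullet> \<xi>))) \<partial>lborel)"
      unfolding of_real_diff levy_op_wave[OF wave_density_wave[OF f]]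
      by (rule Bochner_Integration.integral_diff[OF i i, symmetric])
    also have "\<dots> = (\<integral>\<xi>. (a \<xi> * iexp (x \<bullet> \<xi>)) * ?p \<xi> u \<partial>lborel)"
      by (intro Bochner_Integration.integral_cong refl)
         (simp add: inner_add_left distrib_left exp_add algebra_simps)
    finally show ?thesis .
  qed
  have bound: "cmod (?p \<xi> u * (iexp (u \<bullet> \<zeta>) - 1)) \<le> ?a \<xi> * (1 + norm \<zeta>) * levy_weight u" for \<xi> \<zeta> u
  proof -
    have "cmod (?p \<xi> u * (iexp (u \<bullet> \<zeta>) - 1))
        = cmod (?d \<xi> * ((iexp (u \<bullet> \<xi>) - 1) * (iexp (u \<bullet> \<zeta>) - 1)) - ?r \<xi> u * (iexp (u \<bullet> \<zeta>) - 1))"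
      by (simp add: algebra_simps)
    also have "\<dots> \<le> cmod (?d \<xi>) * cmod ((iexp (u \<bullet> \<xi>) - 1) * (iexp (u \<bullet> \<zeta>) - 1))
        + cmod (?r \<xi> u * (iexp (u \<bullet> \<zeta>) - 1))"
      by (rule order_trans[OF norm_triangle_ineq4]) (simp only: norm_mult order_refl)
    also have "\<dots> \<le> ((K + norm x) * (1 + norm \<xi>)\<^sup>2) * (2 * ((1 + norm \<xi>) * (1 + norm \<zeta>)) * levy_weight u)
        + 2 * ((1 + norm \<xi>) * (1 + norm \<zeta>)) * levy_weight u"
      using K_nonneg by (intro add_mono mult_mono drift_symbol_bound iexp_iexp_bound R_bound) auto
    also have "\<dots> = ?a \<xi> * (1 + norm \<zeta>) * levy_weight u"
      by (simp add: power2_eq_square power3_eq_cube algebra_simps)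
    finally show ?thesis .
  qed
  have inner: "(\<integral>u. ?p \<xi> u * (iexp (u \<bullet> \<zeta>) - 1) \<partial>\<nu>t) = ?d \<xi> * sigma_symbol \<nu>t \<xi> \<zeta> - R \<xi> \<zeta>" for \<xi> \<zeta>
  proof -
    have "(\<integral>u. ?p \<xi> u * (iexp (u \<bullet> \<zeta>) - 1) \<partial>\<nu>t)
        = (\<integral>u. ?d \<xi> * ((iexp (u \<bullet> \<xi>) - 1) * (iexp (u \<bullet> \<zeta>) - 1)) - ?r \<xi> u * (iexp (u \<bullet> \<zeta>) - 1) \<partial>\<nu>t)"
      by (intro Bochner_Integration.integral_cong refl) (simp add: algebra_simps)
    also have "\<dots> = (\<integral>u. ?d \<xi> * ((iexp (u \<bullet> \<xi>) - 1) * (iexp (u \<bullet> \<zeta>) - 1)) \<partial>\<nu>t)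
        - (\<integral>u. ?r \<xi> u * (iexp (u \<bullet> \<zeta>) - 1) \<partial>\<nu>t)"
      by (rule Bochner_Integration.integral_diff[OF integrable_mult_right[OF integrable_sigma] integrable_R])
    also have "\<dots> = ?d \<xi> * sigma_symbol \<nu>t \<xi> \<zeta> - R \<xi> \<zeta>"
      unfolding sigma_symbol_def R_def by (simp only: integral_mult_right_zero)
    finally show ?thesis .
  qed
  have "complex_of_real (Gamma1 \<nu>t (levy_op \<nu> f) g x) = 1 / 2 *
    (\<integral>(\<xi>, \<zeta>). (a \<xi> * iexp (x \<bullet> \<xi>)) * (b \<zeta> * iexp (x \<bullet> \<zeta>)) *
      (\<integral>u. ?p \<xi> u * (iexp (u \<bullet> \<zeta>) - 1) \<partial>\<nu>t) \<partial>(lborel \<Otimes>\<^sub>M lborel))"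
  proof (rule Gamma1_superposition[where a = ?a and p = ?p
        and \<alpha> = "\<lambda>\<xi>. a \<xi> * iexp (x \<bullet> \<xi>)" and \<beta> = "\<lambda>\<xi>. b \<xi> * iexp (x \<bullet> \<xi>)", OF _ _ _ diff wave_density_diff[OF g] bound])
    show "integrable lborel (\<lambda>\<xi>. ?a \<xi> * cmod (a \<xi> * iexp (x \<bullet> \<xi>)))"
      using Bochner_Integration.integrable_add
        [OF integrable_mult_right[OF wave_density_moment[OF f, of 3 x], of "2 * (K + norm x)"]
          integrable_mult_right[OF wave_density_moment[OF f, of 1 x], of 2]]
      by (simp add: algebra_simps)
    show "integrable lborel (\<lambda>\<xi>. (1 + norm \<xi>) * cmod (b \<xi> * iexp (x \<bullet> \<xi>)))"
      using wave_density_moment[OF g, of 1 x] by simp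
  qed measurable
  then show ?thesis unfolding inner .
qed

theorem Gamma2_wave:
  assumes f: "wave_density a f" and g: "wave_density b g"
  shows "complex_of_real (Gamma2 \<nu> \<nu>t f g x) =
    (\<integral>\<zeta>. \<integral>\<xi>. a \<xi> * b \<zeta> * (iexp (x \<bullet> (\<xi> + \<zeta>)) *
      ((sigma_symbol \<nu>t \<xi> \<zeta>)\<^sup>2 / 4 + rho_symbol \<nu>t \<xi> \<zeta> / 4)) \<partial>lborel \<partial>lborel)"
proof -
  have [measurable]: "a \<in> borel_measurable borel" "b \<in> borel_measurable borel"
    using f g by (auto simp: wave_density_def)
  let ?P = "lborel \<Otimes>\<^sub>M lborel :: ('a \<times> 'a) measure"
  let ?\<sigma> = "sigma_symbol \<nu>t"
  let ?d = "\<lambda>\<eta>. \<psi> \<eta> - \<i> * complex_of_real (x \<bullet> \<eta>)"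
  let ?e = "\<lambda>\<xi> \<zeta>. iexp (x \<bullet> (\<xi> + \<zeta>))"
  \<comment> \<open>\<open>Q1\<close>, \<open>Q2\<close> and \<open>Q3\<close> are the symbols of
    the three terms of \<open>Gamma2\<close>, all relative to the density
    \<open>a \<xi> * b \<zeta>\<close>; for \<open>Q3\<close> the roles of f and g are
    exchanged.\<close>
  define Q1 where "Q1 \<xi> \<zeta> = ?e \<xi> \<zeta> * (?\<sigma> \<xi> \<zeta> * ?d (\<xi> + \<zeta>) / 2)" for \<xi> \<zeta>
  define Q2 where "Q2 \<xi> \<zeta> = ?e \<xi> \<zeta> * ((?d \<xi> * ?\<sigma> \<xi> \<zeta> - R \<xi> \<zeta>) / 2)" for \<xi> \<zeta>
  define Q3 where "Q3 \<xi> \<zeta> = Q2 \<zeta> \<xi>" for \<xi> \<zeta>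
  let ?I = "\<lambda>Q. \<integral>(\<xi>, \<zeta>). a \<xi> * b \<zeta> * Q \<xi> \<zeta> \<partial>?P"
  have m1 [measurable]: "(\<lambda>(\<xi>, \<zeta>). Q1 \<xi> \<zeta>) \<in> borel_measurable (borel \<Otimes>\<^sub>M borel)"
    unfolding Q1_def by measurable
  have m2 [measurable]: "(\<lambda>(\<xi>, \<zeta>). Q2 \<xi> \<zeta>) \<in> borel_measurable (borel \<Otimes>\<^sub>M borel)"
    unfolding Q2_def by measurable
  have m3: "(\<lambda>(\<xi>, \<zeta>). Q3 \<xi> \<zeta>) \<in> borel_measurable (borel \<Otimes>\<^sub>M borel)"
    unfolding Q3_def by measurable
  let ?C = "(K + norm x) * K + K"
  let ?n = "\<lambda>\<xi> \<zeta> :: 'a. (1 + norm \<xi>) ^ 3 * (1 + norm \<zeta>) ^ 3"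
  have b1: "cmod (Q1 \<xi> \<zeta>) \<le> ?C * ?n \<xi> \<zeta>" for \<xi> \<zeta>
  proof -
    let ?X = "1 + norm \<xi>" and ?Y = "1 + norm \<zeta>"
    have "cmod (?d (\<xi> + \<zeta>)) \<le> (K + norm x) * (1 + norm (\<xi> + \<zeta>))\<^sup>2"
      by (rule drift_symbol_bound)
    also have "\<dots> \<le> (K + norm x) * (?X * ?Y)\<^sup>2"
      using K_nonneg by (intro mult_left_mono power_mono one_plus_norm_add_le) auto
    finally have "cmod (?\<sigma> \<xi> \<zeta>) * cmod (?d (\<xi> + \<zeta>)) \<le> (K * (?X * ?Y)) * ((K + norm x) * (?X * ?Y)\<^sup>2)"
      using K_nonneg by (intro mult_mono sigma_bound) auto
    also have "\<dots> = ((K + norm x) * K) * ?n \<xi> \<zeta>"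
      by (simp add: power2_eq_square power3_eq_cube)
    also have "\<dots> \<le> ?C * ?n \<xi> \<zeta>"
      using K_nonneg by (intro mult_right_mono) auto
    finally have "cmod (?\<sigma> \<xi> \<zeta>) * cmod (?d (\<xi> + \<zeta>)) / 2 \<le> ?C * ?n \<xi> \<zeta>"
      using mult_nonneg_nonneg[OF norm_ge_zero norm_ge_zero, of "?\<sigma> \<xi> \<zeta>" "?d (\<xi> + \<zeta>)"] by linarith
    then show ?thesis by (simp add: Q1_def norm_mult norm_divide)
  qed
  have b2: "cmod (Q2 \<xi> \<zeta>) \<le> ?C * ?n \<xi> \<zeta>" for \<xi> \<zeta>
  proof -
    let ?X = "1 + norm \<xi>" and ?Y = "1 + norm \<zeta>"
    have "cmod (?d \<xi> * ?\<sigma> \<xi> \<zeta> - R \<xi> \<zeta>) \<le> cmod (?d \<xi>) * cmod (?\<sigma> \<xi> \<zeta>) + cmod (R \<xi> \<zeta>)"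
      by (rule order_trans[OF norm_triangle_ineq4]) (simp only: norm_mult order_refl)
    also have "\<dots> \<le> ((K + norm x) * ?X\<^sup>2) * (K * (?X * ?Y)) + K * (?X * ?Y)"
      using K_nonneg by (intro add_mono mult_mono drift_symbol_bound sigma_bound R_symbol_bound) auto
    also have "\<dots> = (K + norm x) * K * (?X ^ 3 * ?Y ^ 1) + K * (?X ^ 1 * ?Y ^ 1)"
      by (simp add: power2_eq_square power3_eq_cube)
    also have "\<dots> \<le> (K + norm x) * K * ?n \<xi> \<zeta> + K * ?n \<xi> \<zeta>"
      using K_nonneg by (intro add_mono mult_left_mono mult_mono power_increasing) auto
    also have "\<dots> = ?C * ?n \<xi> \<zeta>" by (simp add: distrib_right)
    finally have "cmod (?d \<xi> * ?\<sigma> \<xi> \<zeta> - R \<xi> \<zeta>) / 2 \<le> ?C * ?n \<xi> \<zeta>"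
      using norm_ge_zero[of "?d \<xi> * ?\<sigma> \<xi> \<zeta> - R \<xi> \<zeta>"] by linarith
    then show ?thesis by (simp add: Q2_def norm_mult norm_divide)
  qed
  have b3: "cmod (Q3 \<xi> \<zeta>) \<le> ?C * ?n \<xi> \<zeta>" for \<xi> \<zeta>
    using b2[of \<zeta> \<xi>] by (simp add: Q3_def mult.commute[of "(1 + norm \<zeta>) ^ 3"])
  note i1 = integrable_wave_density_pair[OF f g m1 b1]
  note i2 = integrable_wave_density_pair[OF f g m2 b2]
  note i3 = integrable_wave_density_pair[OF f g m3 b3]
  have e1: "complex_of_real (levy_op \<nu> (Gamma1 \<nu>t f g) x) = ?I Q1"
    unfolding levy_op_wave[OF Gamma1_wave[OF f g]] Q1_def
    by (intro Bochner_Integration.integral_cong refl) (auto simp: split_beta')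
  have e2: "complex_of_real (Gamma1 \<nu>t (levy_op \<nu> f) g x) = ?I Q2"
    unfolding Gamma1_levy_op[OF f g] Q2_def
    by (subst integral_mult_right_zero[symmetric], intro Bochner_Integration.integral_cong refl)
       (auto simp: split_beta' inner_add_right distrib_left exp_add)
  have "complex_of_real (Gamma1 \<nu>t (levy_op \<nu> g) f x) = (\<integral>(\<xi>, \<zeta>). b \<xi> * a \<zeta> * Q2 \<xi> \<zeta> \<partial>?P)"
    unfolding Gamma1_levy_op[OF g f] Q2_def
    by (subst integral_mult_right_zero[symmetric], intro Bochner_Integration.integral_cong refl)
       (auto simp: split_beta' inner_add_right distrib_left exp_add)
  \<comment> \<open>Exchanging the names of the two frequencies attaches \<xi> to f and \<zeta> to g
    again.\<close>
  also have "\<dots> = (\<integral>(\<xi>, \<zeta>). b \<zeta> * a \<xi> * Q2 \<zeta> \<xi> \<partial>?P)"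
  proof -
    have "(\<lambda>(\<xi>, \<zeta>). b \<xi> * a \<zeta> * Q2 \<xi> \<zeta>) \<in> borel_measurable ?P" by measurable
    from lborel_pair.integral_product_swap[OF this] show ?thesis
      by (simp add: split_beta')
  qed
  finally have e3: "complex_of_real (Gamma1 \<nu>t (levy_op \<nu> g) f x) = ?I Q3"
    unfolding Q3_def by (simp only: mult.commute[of "b _"])
  have final: "1 / 2 * (a \<xi> * b \<zeta> * Q1 \<xi> \<zeta> - a \<xi> * b \<zeta> * Q2 \<xi> \<zeta> - a \<xi> * b \<zeta> * Q3 \<xi> \<zeta>)
      = a \<xi> * b \<zeta> * (?e \<xi> \<zeta> * ((?\<sigma> \<xi> \<zeta>)\<^sup>2 / 4 + rho_symbol \<nu>t \<xi> \<zeta> / 4))" for \<xi> \<zeta>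
  proof -
    \<comment> \<open>The terms in x drop out because x.(\<xi> + \<zeta>) splits additively; the
      remaining combination of \<psi> is \<open>sigma_symbol\<close> once more, whence the
      square.\<close>
    have "Q1 \<xi> \<zeta> - Q2 \<xi> \<zeta> - Q3 \<xi> \<zeta>
        = ?e \<xi> \<zeta> * ((?\<sigma> \<xi> \<zeta> * (\<psi> (\<xi> + \<zeta>) - \<psi> \<xi> - \<psi> \<zeta>) + (R \<xi> \<zeta> + R \<zeta> \<xi>)) / 2)"
      unfolding Q1_def Q2_def Q3_def sigma_symbol_commute[of \<zeta> \<xi>] add.commute[of \<zeta> \<xi>]
      by (simp add: inner_add_right field_simps)
    also have "\<dots> = 2 * (?e \<xi> \<zeta> * ((?\<sigma> \<xi> \<zeta>)\<^sup>2 / 4 + rho_symbol \<nu>t \<xi> \<zeta> / 4))"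
      unfolding \<psi>_add rho_symbol_eq by (simp add: power2_eq_square field_simps)
    finally have "Q1 \<xi> \<zeta> - Q2 \<xi> \<zeta> - Q3 \<xi> \<zeta> = \<dots>" .
    moreover have "1 / 2 * (a \<xi> * b \<zeta> * Q1 \<xi> \<zeta> - a \<xi> * b \<zeta> * Q2 \<xi> \<zeta> - a \<xi> * b \<zeta> * Q3 \<xi> \<zeta>)
        = a \<xi> * b \<zeta> * ((Q1 \<xi> \<zeta> - Q2 \<xi> \<zeta> - Q3 \<xi> \<zeta>) / 2)"
      by (simp add: field_simps)
    ultimately show ?thesis by simp
  qed
  have "complex_of_real (Gamma2 \<nu> \<nu>t f g x) = 1 / 2 * (?I Q1 - ?I Q2 - ?I Q3)"
    unfolding Gamma2_def e1[symmetric] e2[symmetric] e3[symmetric] by simp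
  also have "\<dots> = 1 / 2 * (\<integral>p. (case p of (\<xi>, \<zeta>) \<Rightarrow> a \<xi> * b \<zeta> * Q1 \<xi> \<zeta>)
      - (case p of (\<xi>, \<zeta>) \<Rightarrow> a \<xi> * b \<zeta> * Q2 \<xi> \<zeta>) - (case p of (\<xi>, \<zeta>) \<Rightarrow> a \<xi> * b \<zeta> * Q3 \<xi> \<zeta>) \<partial>?P)"
    by (simp only: Bochner_Integration.integral_diff Bochner_Integration.integrable_diff i1 i2 i3)
  also have "\<dots> = (\<integral>(\<xi>, \<zeta>). 1 / 2 * (a \<xi> * b \<zeta> * Q1 \<xi> \<zeta> - a \<xi> * b \<zeta> * Q2 \<xi> \<zeta> - a \<xi> * b \<zeta> * Q3 \<xi> \<zeta>) \<partial>?P)"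
    by (subst integral_mult_right_zero[symmetric]) (simp only: split_beta')
  also have "\<dots> = (\<integral>\<zeta>. \<integral>\<xi>. 1 / 2 * (a \<xi> * b \<zeta> * Q1 \<xi> \<zeta> - a \<xi> * b \<zeta> * Q2 \<xi> \<zeta> - a \<xi> * b \<zeta> * Q3 \<xi> \<zeta>) \<partial>lborel \<partial>lborel)"
  proof (rule lborel_pair.integral_snd[symmetric])
    have "integrable ?P (\<lambda>p. 1 / 2 * ((case p of (\<xi>, \<zeta>) \<Rightarrow> a \<xi> * b \<zeta> * Q1 \<xi> \<zeta>)
      - (case p of (\<xi>, \<zeta>) \<Rightarrow> a \<xi> * b \<zeta> * Q2 \<xi> \<zeta>) - (case p of (\<xi>, \<zeta>) \<Rightarrow> a \<xi> * b \<zeta> * Q3 \<xi> \<zeta>)))"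
      by (intro integrable_mult_right Bochner_Integration.integrable_diff i1 i2 i3)
    then show "integrable ?P (\<lambda>(\<xi>, \<zeta>). 1 / 2 * (a \<xi> * b \<zeta> * Q1 \<xi> \<zeta> - a \<xi> * b \<zeta> * Q2 \<xi> \<zeta> - a \<xi> * b \<zeta> * Q3 \<xi> \<zeta>))"
      by (simp only: split_beta')
  qed
  finally show ?thesis unfolding final .
qed

end

theorem lemma5p1:
  fixes \<nu> \<nu>t \<sigma> :: "'a::euclidean_space measure"
    and k :: "'a \<Rightarrow> real \<Rightarrow> real"
    and f g :: "'a \<Rightarrow> real"
    and x :: 'a
  assumes "levy_measure \<nu>"
    and "(\<integral>\<^sup>+u\<in>{u. norm u \<ge> 1}. ennreal (norm u) \<partial>\<nu>) < \<infinity>"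
    and "sets \<sigma> = sets (restrict_space borel (sphere (0::'a) 1))"
    and "finite_measure \<sigma>"
    and "\<And>y r. y \<in> sphere 0 1 \<Longrightarrow> r > 0 \<Longrightarrow> k y r \<ge> 0"
    and "\<And>y. y \<in> sphere 0 1 \<Longrightarrow> continuous_on {0<..} (k y)"
    and "\<And>y. y \<in> sphere 0 1 \<Longrightarrow> antimono_on {0<..} (k y)"
    and "\<And>r. r > 0 \<Longrightarrow> continuous_on (sphere 0 1) (\<lambda>y. k y r)"
    and "\<And>y. y \<in> sphere 0 1 \<Longrightarrow> (k y \<longlongrightarrow> 0) at_top"
    and "\<And>y. y \<in> sphere 0 1 \<Longrightarrow> ((\<lambda>r. r\<^sup>2 * k y r) \<longlongrightarrow> 0) (at_right 0)"
    and "\<nu> = polar_measure \<sigma> (\<lambda>y. density lborel (\<lambda>r. indicator {0<..} r * ennreal (k y r / r)))"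
    and "\<nu>t = polar_measure \<sigma> (\<lambda>y. neg_stieltjes (k y))"
    and "schwartz f" and "schwartz g"
  shows "complex_of_real (Gamma2 \<nu> \<nu>t f g x) =
    (\<integral>\<zeta>. (\<integral>\<xi>. fourier f \<xi> * fourier g \<zeta> * exp (\<i> * complex_of_real (x \<bullet> (\<xi> + \<zeta>)))
        * ((sigma_symbol \<nu>t \<xi> \<zeta>)\<^sup>2 / 4 + rho_symbol \<nu>t \<xi> \<zeta> / 4)
        / complex_of_real ((2 * pi) ^ (2 * DIM('a))) \<partial>lborel) \<partial>lborel)"
proof -
  have weight: "(\<integral>\<^sup>+u. ennreal (levy_weight u) \<partial>\<nu>) < \<infinity>"
  proof -
    have [measurable_cong]: "sets \<nu> = sets borel" by (simp add: assms(11))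
    \<comment> \<open>Small jumps are covered by the Levy condition, large ones by the first
      moment.\<close>
    have "(\<integral>\<^sup>+u. ennreal (levy_weight u) \<partial>\<nu>)
        \<le> (\<integral>\<^sup>+u. ennreal (min 1 ((norm u)\<^sup>2)) + ennreal (norm u) * indicator {u. norm u \<ge> 1} u \<partial>\<nu>)"
      by (intro nn_integral_mono) (auto simp: levy_weight_def indicator_def ennreal_leI add_increasing)
    also have "\<dots> = (\<integral>\<^sup>+u. ennreal (min 1 ((norm u)\<^sup>2)) \<partial>\<nu>)
        + (\<integral>\<^sup>+u\<in>{u. norm u \<ge> 1}. ennreal (norm u) \<partial>\<nu>)"
      by (rule nn_integral_add) measurable
    also have "\<dots> < \<infinity>"
      using assms(1,2) by (simp add: levy_measure_def)
    finally show ?thesis .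
  qed
  interpret P: polar_levy \<sigma> k
    using assms(3,5-9) by unfold_locales auto
  interpret L: levy_pair \<nu> \<nu>t
  proof
    show "emeasure \<nu> {0} = 0" using assms(1) by (simp add: levy_measure_def)
    show "emeasure \<nu>t {0} = 0" unfolding assms(12) by (rule P.emeasure_\<nu>t_0)
    show "(\<integral>\<^sup>+u. H u \<partial>\<nu>)
        = (\<integral>\<^sup>+v. \<integral>\<^sup>+s. indicator {0<..<1} s * ennreal (1 / s) * H (s *\<^sub>R v) \<partial>lborel \<partial>\<nu>t)"
      if "H \<in> borel_measurable borel" for H
      unfolding assms(11,12) using that by (rule P.nn_integral_\<nu>)
  qed (use weight in \<open>simp_all add: assms(11,12)\<close>)
  \<comment> \<open>Each of the two densities carries one factor (2 pi)^d.\<close>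
  have eq: "(2 * pi) ^ (2 * DIM('a)) = (2 * pi) ^ DIM('a) * (2 * pi) ^ DIM('a)"
    by (simp only: mult_2 power_add)
  show ?thesis
    unfolding eq L.Gamma2_wave[OF wave_density_schwartz[OF assms(13)] wave_density_schwartz[OF assms(14)]]
    by (intro Bochner_Integration.integral_cong refl)
       (simp only: of_real_mult times_divide_eq_left times_divide_eq_right divide_divide_eq_left mult_ac)
qed

end
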